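(* There exists $n_0$ such that the following hold. (a) If $n\equiv 1 \pmod 8$ and $n>n_0$, then $C(n,2,3)=\frac{n(n-1)}{8}$. (b) If $n\equiv 1 \pmod{342}$ or $n\equiv 19 \pmod{342}$, and $n>n_0$, then $C(n,3,5)=\frac{n(n-1)}{18}$.
   Context: Let $X=[n]=\{1,\dots,n\}$ and let $k$ be an integer with $0<k\le n/2$. Let $\mathcal Y$ be the family of unordered pairs $\{A_1,A_2\}$ of disjoint $k$-element subsets of $X$. The (transportation) distance on $\mathcal Y$ is $d(\{A_1,A_2\},\{B_1,B_2\})=\min\{|A_1\setminus B_1|+|A_2\setminus B_2|,\ |A_1\setminus B_2|+|A_2\setminus B_1|\}$. For an integer $d$, $C(n,k,d)$ denotes the maximum size of a subfamily of $\mathcal Y$ in which any two distinct members have distance at least $d$. *)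

theory Defs
  imports Complex_Main "HOL-Number_Theory.Cong"
begin

(* An unordered pair {A1, A2} is the two-element set of sets {A1, A2};
   disjoint A1, A2 of the same positive cardinality are automatically distinct. *)
definition disjoint_pairs :: "nat \<Rightarrow> nat \<Rightarrow> nat set set set" where
  "disjoint_pairs n k =
     {{A1, A2} | A1 A2. A1 \<subseteq> {1..n} \<and> A2 \<subseteq> {1..n} \<and>
        card A1 = k \<and> card A2 = k \<and> A1 \<inter> A2 = {}}"

(* The value does not depend on how the two pairs are enumerated, see transport_dist_pair. *)
definition transport_dist :: "'a set set \<Rightarrow> 'a set set \<Rightarrow> nat" where
  "transport_dist P Q = (THE m. \<exists>A1 A2 B1 B2. P = {A1, A2} \<and> Q = {B1, B2} \<and>
     m = min (card (A1 - B1) + card (A2 - B2)) (card (A1 - B2) + card (A2 - B1)))"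

lemma transport_dist_pair:
  "transport_dist {A1, A2} {B1, B2} =
     min (card (A1 - B1) + card (A2 - B2)) (card (A1 - B2) + card (A2 - B1))"
  unfolding transport_dist_def
  by (rule the_equality, blast, auto simp: doubleton_eq_iff min.commute add.commute)

definition is_code :: "nat \<Rightarrow> nat \<Rightarrow> nat \<Rightarrow> nat set set set \<Rightarrow> bool" where
  "is_code n k d F \<longleftrightarrow> F \<subseteq> disjoint_pairs n k \<and>
     (\<forall>P\<in>F. \<forall>Q\<in>F. P \<noteq> Q \<longrightarrow> d \<le> transport_dist P Q)"

definition max_code :: "nat \<Rightarrow> nat \<Rightarrow> nat \<Rightarrow> nat" where
  "max_code n k d = Max {card F | F. is_code n k d F}"

lemma finite_disjoint_pairs: "finite (disjoint_pairs n k)"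
  by (rule finite_subset[of _ "Pow (Pow {1..n})"]) (auto simp: disjoint_pairs_def)

lemma finite_code_sizes: "finite {card F | F. is_code n k d F}"
proof -
  have "{card F | F. is_code n k d F} \<subseteq> card ` Pow (disjoint_pairs n k)"
    by (auto simp: is_code_def)
  then show ?thesis
    by (rule finite_subset) (simp add: finite_disjoint_pairs)
qed

lemma code_sizes_nonempty: "{card F | F. is_code n k d F} \<noteq> {}"
proof -
  have "is_code n k d {}" by (simp add: is_code_def)
  then show ?thesis by blast
qed

end

theory Submission
  imports Defs "HOL-Library.Product_Plus"
begin

text \<open>
  Call the \<open>k\<^sup>2\<close> cross pairs of a block \<open>{A, B}\<close> red and the pairs inside \<open>A\<close> or inside \<open>B\<close> blue. A code with
  distance \<open>2 k - 1\<close> uses no red pair twice, whence the upper bound \<open>n (n - 1) / (2 k\<^sup>2)\<close>. It is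
  attained once the red pairs of some blocks partition the edges of \<open>K\<^sub>n\<close> and no blue pair is repeated.

  Such decompositions are additive over edge-disjoint unions. With \<open>w = 2 k\<^sup>2\<close> it suffices to
  decompose \<open>K\<close> on \<open>w + 1\<close> points and the complete multipartite graph with \<open>m\<close> parts of size \<open>w\<close>, for all large \<open>m\<close>:
  add one point at infinity and fill in each part. If \<open>m\<close> is coprime to \<open>30\<close>, a difference family over
  \<open>\<int>\<^sub>m \<times> \<int>\<^sub>w\<close> works, consisting of two fixed blocks with the first coordinate scaled by
  \<open>0 < x < m / 2\<close>. Any other large \<open>m\<close> is \<open>7 N + s + t\<close> with \<open>N\<close> coprime to \<open>210\<close>, \<open>s \<le> N\<close> coprime to \<open>30\<close>
  and \<open>t \<le> 1\<close>. A transversal design over \<open>\<int>\<^sub>N\<close> with two truncated groups then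
  reduces \<open>m\<close> parts to \<open>7, 8, 9, N, s\<close> and \<open>t\<close> parts, and \<open>8\<close> and \<open>9\<close> parts are handled by cyclic
  difference families. All base blocks were found by computer search.
\<close>

section \<open>Decompositions into coloured blocks\<close>

text \<open>Graphs are symmetric irreflexive relations, so every pair is counted in both orders.\<close>

definition red :: "'a set \<times> 'a set \<Rightarrow> ('a \<times> 'a) set" where
  "red P = fst P \<times> snd P \<union> snd P \<times> fst P"

definition blue :: "'a set \<times> 'a set \<Rightarrow> ('a \<times> 'a) set" where
  "blue P = (fst P \<times> fst P \<union> snd P \<times> snd P) - Id"

lemma red_image: "red (map_prod ((`) f) ((`) f) P) = map_prod f f ` red P"
proof -
  have "map_prod f f ` (A \<times> B) = f ` A \<times> f ` B" for A B by force
  then show ?thesis unfolding red_def by (simp add: image_Un)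
qed

text \<open>Unlike \<open>red_image\<close>, this depends on injectivity: two points merged by
  \<open>f\<close> would turn a blue pair into a loop, which the removal of \<open>Id\<close>
  discards.\<close>

lemma blue_image:
  assumes "inj_on f (fst P \<union> snd P)"
  shows "blue (map_prod ((`) f) ((`) f) P) = map_prod f f ` blue P"
proof -
  have inj: "inj_on f (fst P)" "inj_on f (snd P)"
    using assms by (auto intro: inj_on_subset)
  have "map_prod f f ` (A \<times> A - Id) = f ` A \<times> f ` A - Id" if "inj_on f A" for A
  proof
    show "map_prod f f ` (A \<times> A - Id) \<subseteq> f ` A \<times> f ` A - Id"
      using that by (auto dest: inj_onD)
    show "f ` A \<times> f ` A - Id \<subseteq> map_prod f f ` (A \<times> A - Id)" by auto
  qed
  with inj show ?thesis unfolding blue_def by (simp add: image_Un Un_Diff)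
qed

text \<open>The red pairs partition \<open>E\<close>, while the blue pairs are only packed into it.
  Confining blue pairs to \<open>E\<close> is what makes designs additive: blocks from edge-disjoint
  graphs cannot share a pair of either colour. A block is stored as an ordered pair, but both
  colours are symmetric under swapping its sides.\<close>

definition design :: "nat \<Rightarrow> ('a \<times> 'a) set \<Rightarrow> ('a set \<times> 'a set) set \<Rightarrow> bool" where
  "design k E F \<longleftrightarrow>
     (\<forall>P\<in>F. card (fst P) = k \<and> card (snd P) = k \<and> fst P \<inter> snd P = {} \<and> blue P \<subseteq> E) \<and>
     (\<Union>P\<in>F. red P) = E \<and>
     (\<forall>P\<in>F. \<forall>Q\<in>F. P \<noteq> Q \<longrightarrow> red P \<inter> red Q = {} \<and> blue P \<inter> blue Q = {})"

definition decomposable :: "nat \<Rightarrow> ('a \<times> 'a) set \<Rightarrow> bool" where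
  "decomposable k E \<longleftrightarrow> (\<exists>F. design k E F)"

lemma designD:
  assumes "design k E F" "P \<in> F"
  shows "card (fst P) = k" "card (snd P) = k" "fst P \<inter> snd P = {}" "red P \<subseteq> E" "blue P \<subseteq> E"
proof -
  have "red P \<subseteq> (\<Union>P\<in>F. red P)" using assms(2) by (rule UN_upper)
  then show "red P \<subseteq> E" using assms(1) by (simp add: design_def)
qed (use assms in \<open>simp_all add: design_def\<close>)

lemma design_disjoint:
  assumes "design k E F" "P \<in> F" "Q \<in> F" "P \<noteq> Q"
  shows "red P \<inter> red Q = {}" "blue P \<inter> blue Q = {}"
  using assms by (simp_all add: design_def)

lemma design_cover: "design k E F \<Longrightarrow> (\<Union>P\<in>F. red P) = E"
  by (simp add: design_def)

lemma decomposable_empty: "decomposable k {}"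
  unfolding decomposable_def design_def by (rule exI[of _ "{}"]) simp

lemma decomposable_UN:
  assumes dec: "\<And>i. i \<in> I \<Longrightarrow> decomposable k (E i)"
    and disj: "\<And>i j. i \<in> I \<Longrightarrow> j \<in> I \<Longrightarrow> i \<noteq> j \<Longrightarrow> E i \<inter> E j = {}"
  shows "decomposable k (\<Union>i\<in>I. E i)"
proof -
  from dec obtain F where F: "\<And>i. i \<in> I \<Longrightarrow> design k (E i) (F i)"
    unfolding decomposable_def by metis
  have "design k (\<Union>i\<in>I. E i) (\<Union>i\<in>I. F i)"
    unfolding design_def
  proof (intro conjI ballI impI)
    fix P assume "P \<in> (\<Union>i\<in>I. F i)"
    then obtain i where i: "i \<in> I" "P \<in> F i" by blast
    note D = designD[OF F[OF i(1)] i(2)]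
    show "card (fst P) = k" "card (snd P) = k" "fst P \<inter> snd P = {}" by (rule D)+
    show "blue P \<subseteq> (\<Union>i\<in>I. E i)" using D(5) i(1) by blast
  next
    have "(\<Union>P\<in>F i. red P) = E i" if "i \<in> I" for i
      using design_cover[OF F[OF that]] .
    then show "(\<Union>P\<in>(\<Union>i\<in>I. F i). red P) = (\<Union>i\<in>I. E i)" by auto
  next
    fix P Q assume P: "P \<in> (\<Union>i\<in>I. F i)" and Q: "Q \<in> (\<Union>i\<in>I. F i)" and ne: "P \<noteq> Q"
    from P obtain i where i: "i \<in> I" "P \<in> F i" by blast
    from Q obtain j where j: "j \<in> I" "Q \<in> F j" by blast
    have sub: "red R \<subseteq> E l \<and> blue R \<subseteq> E l" if "l \<in> I" "R \<in> F l" for l R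
      using designD(4,5)[OF F[OF that(1)] that(2)] by simp
    have "red P \<inter> red Q = {} \<and> blue P \<inter> blue Q = {}"
    proof (cases "i = j")
      case True
      with design_disjoint[OF F[OF i(1)] i(2)] j ne show ?thesis by simp
    next
      case False
      with disj[OF i(1) j(1)] sub[OF i] sub[OF j] show ?thesis by blast
    qed
    then show "red P \<inter> red Q = {}" "blue P \<inter> blue Q = {}" by auto
  qed
  then show ?thesis unfolding decomposable_def by blast
qed

lemma decomposable_Un:
  assumes "decomposable k E" "decomposable k E'" "E \<inter> E' = {}"
  shows "decomposable k (E \<union> E')"
proof -
  have "decomposable k (\<Union>b\<in>{True, False}. if b then E else E')"
    by (rule decomposable_UN) (use assms in auto)
  then show ?thesis by (simp add: Un_commute)
qed

text \<open>As \<open>k > 0\<close>, every point of a block lies on one of its red pairs, hence in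
  \<open>V\<close>. So injectivity of \<open>f\<close> on \<open>V\<close> alone keeps sizes,
  disjointness and both colours intact.\<close>

lemma decomposable_image:
  assumes dec: "decomposable k E" and sub: "E \<subseteq> V \<times> V" and inj: "inj_on f V" and k: "k > 0"
  shows "decomposable k (map_prod f f ` E)"
proof -
  from dec obtain F where F: "design k E F" unfolding decomposable_def by blast
  let ?f = "map_prod ((`) f) ((`) f)"
  have V: "fst P \<subseteq> V" "snd P \<subseteq> V" if "P \<in> F" for P
  proof -
    note r = designD(4)[OF F that]
    have "card (fst P) = k" "card (snd P) = k" using designD[OF F that] by auto
    with k have "fst P \<noteq> {}" "snd P \<noteq> {}" by auto
    with r sub show "fst P \<subseteq> V" "snd P \<subseteq> V" unfolding red_def by blast+
  qed
  note red = red_image[of f]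
  have blue: "blue (?f P) = map_prod f f ` blue P" if "P \<in> F" for P
    using V[OF that] inj by (intro blue_image) (auto intro: inj_on_subset)
  have injm: "inj_on (map_prod f f) (V \<times> V)"
    using inj by (simp add: map_prod_inj_on)
  have subE: "red P \<subseteq> E" "blue P \<subseteq> E" if "P \<in> F" for P
    using designD[OF F that] by auto
  have "design k (map_prod f f ` E) (?f ` F)"
    unfolding design_def
  proof (intro conjI ballI impI)
    fix Q assume "Q \<in> ?f ` F"
    then obtain P where P: "P \<in> F" "Q = ?f P" by (elim imageE)
    have "inj_on f (fst P)" "inj_on f (snd P)"
      using V[OF P(1)] inj_on_subset[OF inj] by simp_all
    with designD[OF F P(1)] show "card (fst Q) = k" "card (snd Q) = k"
      unfolding P(2) by (simp_all add: card_image)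
    have "fst P \<inter> snd P = {}" using designD[OF F P(1)] by simp
    with V[OF P(1)] inj_on_image_Int[OF inj, of "fst P" "snd P"] show "fst Q \<inter> snd Q = {}"
      unfolding P(2) by simp
    show "blue Q \<subseteq> map_prod f f ` E"
      unfolding P(2) blue[OF P(1)] by (rule image_mono[OF subE(2)[OF P(1)]])
  next
    show "(\<Union>Q\<in>?f ` F. red Q) = map_prod f f ` E"
      using design_cover[OF F] by (simp add: red image_UN[symmetric])
  next
    fix Q Q' assume "Q \<in> ?f ` F" "Q' \<in> ?f ` F" and ne: "Q \<noteq> Q'"
    then obtain P P' where P: "P \<in> F" "Q = ?f P" and P': "P' \<in> F" "Q' = ?f P'" by (elim imageE)
    with ne have "P \<noteq> P'" by blast
    note d = design_disjoint[OF F P(1) P'(1) this]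
    have sub': "red P \<subseteq> V \<times> V" "red P' \<subseteq> V \<times> V" "blue P \<subseteq> V \<times> V" "blue P' \<subseteq> V \<times> V"
      using subE[OF P(1)] subE[OF P'(1)] sub by auto
    show "red Q \<inter> red Q' = {}"
      unfolding P(2) P'(2) red inj_on_image_Int[OF injm sub'(1,2), symmetric] d by simp
    show "blue Q \<inter> blue Q' = {}"
      unfolding P(2) P'(2) blue[OF P(1)] blue[OF P'(1)]
        inj_on_image_Int[OF injm sub'(3,4), symmetric] d by simp
  qed
  then show ?thesis unfolding decomposable_def by blast
qed

section \<open>Complete and multipartite graphs: relabelling and gluing\<close>

definition multipartite :: "'a set \<Rightarrow> nat \<Rightarrow> (('a \<times> nat) \<times> ('a \<times> nat)) set" where
  "multipartite S w = {((a, i), (b, j)). a \<in> S \<and> b \<in> S \<and> a \<noteq> b \<and> i < w \<and> j < w}"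

definition complete_graph :: "'a set \<Rightarrow> ('a \<times> 'a) set" where
  "complete_graph S = S \<times> S - Id"

lemma decomposable_complete_transfer:
  assumes dec: "decomposable k (complete_graph S)" and "finite S" "finite T" "card S = card T" "k > 0"
  shows "decomposable k (complete_graph T)"
proof -
  obtain f where f: "bij_betw f S T" using assms finite_same_card_bij by blast
  have "map_prod f f ` complete_graph S = complete_graph T"
    using f unfolding bij_betw_def complete_graph_def inj_on_def by (auto simp: image_iff) 
  moreover have "decomposable k (map_prod f f ` complete_graph S)"
    by (rule decomposable_image[OF dec, of S]) (use f assms in \<open>auto simp: complete_graph_def bij_betw_def\<close>)
  ultimately show ?thesis by simp
qed

lemma decomposable_multipartite_transfer:
  assumes dec: "decomposable k (multipartite S w)" and "finite S" "finite T" "card S = card T" "k > 0"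
  shows "decomposable k (multipartite T w)"
proof -
  obtain f where f: "bij_betw f S T" using assms finite_same_card_bij by blast
  let ?f = "map_prod f id"
  have inj: "inj_on f S" and T: "T = f ` S" using f by (auto simp: bij_betw_def)
  have "map_prod ?f ?f ` multipartite S w = multipartite T w"
  proof
    show "map_prod ?f ?f ` multipartite S w \<subseteq> multipartite T w"
      unfolding multipartite_def T using inj by (auto dest: inj_onD)
    show "multipartite T w \<subseteq> map_prod ?f ?f ` multipartite S w"
    proof
      fix e assume "e \<in> multipartite T w"
      then obtain a i b j where e: "e = ((f a, i), (f b, j))" "a \<in> S" "b \<in> S" "f a \<noteq> f b" "i < w" "j < w"
        unfolding multipartite_def T by auto
      then show "e \<in> map_prod ?f ?f ` multipartite S w"
        by (intro image_eqI[of _ _ "((a, i), (b, j))"]) (auto simp: multipartite_def)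
    qed
  qed
  moreover have "decomposable k (map_prod ?f ?f ` multipartite S w)"
  proof (rule decomposable_image[OF dec])
    show "multipartite S w \<subseteq> (S \<times> UNIV) \<times> (S \<times> UNIV)" by (auto simp: multipartite_def)
    show "inj_on ?f (S \<times> UNIV)" using inj by (auto simp: inj_on_def)
  qed fact
  ultimately show ?thesis by simp
qed

text \<open>The sets \<open>T i\<close> form a pairwise balanced design on \<open>S\<close>.
  Replacing each point by \<open>w\<close> copies turns the block through two points into the only
  subgraph containing the edges between their copies, so the graphs on the blocks partition the
  whole multipartite graph.\<close>

lemma decomposable_pairwise_balanced:
  assumes dec: "\<And>i. i \<in> I \<Longrightarrow> decomposable k (multipartite (T i) w)"
    and cover: "\<And>a b. a \<in> S \<Longrightarrow> b \<in> S \<Longrightarrow> a \<noteq> b \<Longrightarrow> \<exists>i\<in>I. a \<in> T i \<and> b \<in> T i"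
    and once: "\<And>a b i j. i \<in> I \<Longrightarrow> j \<in> I \<Longrightarrow> a \<noteq> b \<Longrightarrow> {a, b} \<subseteq> T i \<Longrightarrow> {a, b} \<subseteq> T j \<Longrightarrow> i = j"
    and sub: "\<And>i. i \<in> I \<Longrightarrow> T i \<subseteq> S"
  shows "decomposable k (multipartite S w)"
proof -
  have "decomposable k (\<Union>i\<in>I. multipartite (T i) w)"
  proof (rule decomposable_UN[OF dec])
    fix i j assume "i \<in> I" "j \<in> I" "i \<noteq> j"
    then show "multipartite (T i) w \<inter> multipartite (T j) w = {}"
      using once[of i j] unfolding multipartite_def by blast
  qed
  moreover have "(\<Union>i\<in>I. multipartite (T i) w) = multipartite S w"
    using sub cover unfolding multipartite_def by (auto; blast)
  ultimately show ?thesis by simp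
qed

text \<open>\<open>None\<close> is the point at infinity. Each part together with
  \<open>None\<close> is a set \<open>V a\<close> of \<open>w + 1\<close> points; two such sets meet
  only in \<open>None\<close>, so their complete graphs are edge-disjoint, and they supply exactly
  the edges missing from the multipartite graph.\<close>

lemma decomposable_complete_of_multipartite:
  assumes mp: "decomposable k (multipartite {..<m} w)"
    and cp: "decomposable k (complete_graph {..w})" and k: "k > 0"
  shows "decomposable k (complete_graph {1..m * w + 1})"
proof -
  define V :: "nat \<Rightarrow> (nat \<times> nat) option set"
    where "V a = insert None (Some ` ({a} \<times> {..<w}))" for a
  define S :: "(nat \<times> nat) option set" where "S = insert None (Some ` ({..<m} \<times> {..<w}))"
  have cardV: "card (V a) = w + 1" "finite (V a)" for a
    unfolding V_def by (auto simp: card_insert_if card_image card_cartesian_product)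
  have cardS: "card S = m * w + 1" "finite S"
    unfolding S_def by (auto simp: card_insert_if card_image card_cartesian_product)
  have "decomposable k (map_prod Some Some ` multipartite {..<m} w)"
    by (rule decomposable_image[OF mp, of UNIV]) (use k in auto)
  moreover have "decomposable k (\<Union>a\<in>{..<m}. complete_graph (V a))"
  proof (rule decomposable_UN)
    fix a :: nat
    show "decomposable k (complete_graph (V a))"
      by (rule decomposable_complete_transfer[OF cp]) (use cardV k in auto)
  qed (auto simp: V_def complete_graph_def)
  ultimately have "decomposable k (map_prod Some Some ` multipartite {..<m} w \<union> (\<Union>a\<in>{..<m}. complete_graph (V a)))"
    by (rule decomposable_Un) (auto simp: V_def complete_graph_def multipartite_def)
  moreover have "map_prod Some Some ` multipartite {..<m} w \<union> (\<Union>a\<in>{..<m}. complete_graph (V a)) = complete_graph S" (is "?L = _")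
  proof
    show "?L \<subseteq> complete_graph S"
      unfolding V_def S_def complete_graph_def multipartite_def by auto
    show "complete_graph S \<subseteq> ?L"
    proof
      fix e assume e: "e \<in> complete_graph S"
      then obtain x y where xy: "e = (x, y)" "x \<in> S" "y \<in> S" "x \<noteq> y" unfolding complete_graph_def by auto
      show "e \<in> ?L"
      proof (cases "\<exists>a i b j. x = Some (a, i) \<and> y = Some (b, j) \<and> a \<noteq> b")
        case True
        then obtain a i b j where ab: "x = Some (a, i)" "y = Some (b, j)" "a \<noteq> b" by blast
        with xy have "((a, i), (b, j)) \<in> multipartite {..<m} w"
          unfolding S_def multipartite_def by auto
        then have "map_prod Some Some ((a, i), (b, j)) \<in> map_prod Some Some ` multipartite {..<m} w"
          by (rule imageI)
        then show ?thesis using xy ab by simp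
      next
        case False
        with xy have "\<exists>a<m. x \<in> V a \<and> y \<in> V a" unfolding S_def V_def by auto
        with xy show ?thesis unfolding complete_graph_def by auto
      qed
    qed
  qed
  ultimately have "decomposable k (complete_graph S)" by simp
  then show ?thesis
    by (rule decomposable_complete_transfer) (use cardS k in auto)
qed

section \<open>Codes and decompositions of the complete graph\<close>

lemma card_complete_graph: "card (complete_graph {1..n::nat}) = n * (n - 1)"
proof -
  have "complete_graph {1..n} = {1..n} \<times> {1..n} - (\<lambda>x. (x, x)) ` {1..n}"
    unfolding complete_graph_def by auto
  then have "card (complete_graph {1..n}) = n * n - n"
    by (simp add: card_Diff_subset image_subset_iff card_image inj_on_def)
  then show ?thesis by (simp add: diff_mult_distrib2)
qed

lemma card_red:
  assumes "card (fst P) = k" "card (snd P) = k" "fst P \<inter> snd P = {}" "k > 0"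
  shows "card (red P) = 2 * k ^ 2" "finite (red P)"
proof -
  have fin: "finite (fst P)" "finite (snd P)" using assms by (auto intro: card_ge_0_finite)
  then show "finite (red P)" unfolding red_def by simp
  have "fst P \<times> snd P \<inter> snd P \<times> fst P = {}" using assms(3) by auto
  then show "card (red P) = 2 * k ^ 2"
    unfolding red_def using fin assms by (simp add: card_Un_disjoint card_cartesian_product power2_eq_square)
qed

text \<open>Two common points lie either on different sides, which gives a common red pair, or on
  the same side, which gives a common blue pair. Read contrapositively, blocks of a design agree in
  at most one point under each matching of their sides, so each matching costs at least
  \<open>2 * k - 1\<close>.\<close>

lemma shared_pair:
  assumes fin: "finite A" "finite B" and "A \<inter> B = {}" and 2: "card (A \<inter> C) + card (B \<inter> D) \<ge> 2"
  shows "red (A, B) \<inter> red (C, D) \<noteq> {} \<or> blue (A, B) \<inter> blue (C, D) \<noteq> {}"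
proof -
  consider "card (A \<inter> C) \<ge> 1" "card (B \<inter> D) \<ge> 1" | "card (A \<inter> C) \<ge> 2" | "card (B \<inter> D) \<ge> 2"
    using 2 by linarith
  then show ?thesis
  proof cases
    case 1
    then obtain x y where "x \<in> A \<inter> C" "y \<in> B \<inter> D" using fin by (auto simp: Suc_le_eq card_gt_0_iff)
    then have "(x, y) \<in> red (A, B) \<inter> red (C, D)" unfolding red_def by auto
    then show ?thesis by blast
  next
    case 2
    then obtain x y where "x \<in> A \<inter> C" "y \<in> A \<inter> C" "x \<noteq> y"
      using fin card_le_Suc0_iff_eq[of "A \<inter> C"] by fastforce
    then have "(x, y) \<in> blue (A, B) \<inter> blue (C, D)" unfolding blue_def by auto
    then show ?thesis by blast
  next
    case 3
    then obtain x y where "x \<in> B \<inter> D" "y \<in> B \<inter> D" "x \<noteq> y"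
      using fin card_le_Suc0_iff_eq[of "B \<inter> D"] by fastforce
    then have "(x, y) \<in> blue (A, B) \<inter> blue (C, D)" unfolding blue_def by auto
    then show ?thesis by blast
  qed
qed

text \<open>Forgetting the order of the two sides yields the code. Its size follows by counting the
  \<open>n * (n - 1)\<close> ordered edges, since each block accounts for \<open>2 * k ^ 2\<close>
  ordered red pairs.\<close>

lemma code_of_design:
  assumes F: "design k (complete_graph {1..n}) F" and k: "k > 0"
  shows "\<exists>C. is_code n k (2 * k - 1) C \<and> card C * (2 * k ^ 2) = n * (n - 1)"
proof -
  let ?pr = "\<lambda>P. {fst P, snd P}"
  have fin: "finite (fst P)" "finite (snd P)" if "P \<in> F" for P
    using designD(1,2)[OF F that] k by (auto intro: card_ge_0_finite)
  have V: "fst P \<subseteq> {1..n}" "snd P \<subseteq> {1..n}" if "P \<in> F" for P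
  proof -
    have "fst P \<noteq> {}" "snd P \<noteq> {}" using designD(1,2)[OF F that] k by auto
    with designD(4)[OF F that] show "fst P \<subseteq> {1..n}" "snd P \<subseteq> {1..n}"
      unfolding red_def complete_graph_def by blast+
  qed
  have finF: "finite F"
  proof (rule finite_subset)
    show "F \<subseteq> Pow {1..n} \<times> Pow {1..n}" using V by (simp add: subset_iff mem_Times_iff)
  qed simp
  \<comment> \<open>Two ordered versions of one block would have the same nonempty red set, against
    disjointness.\<close>
  have inj: "inj_on ?pr F"
  proof (rule inj_onI, rule ccontr)
    fix P Q assume PQ: "P \<in> F" "Q \<in> F" "?pr P = ?pr Q" "P \<noteq> Q"
    then have "red P = red Q" unfolding red_def by (auto simp: doubleton_eq_iff)
    moreover have "red P \<noteq> {}" using card_red(1)[OF designD(1-3)[OF F PQ(1)] k] k by auto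
    ultimately show False using design_disjoint(1)[OF F PQ(1,2,4)] by simp
  qed
  have "n * (n - 1) = card (\<Union>P\<in>F. red P)"
    unfolding design_cover[OF F] card_complete_graph ..
  also have "\<dots> = (\<Sum>P\<in>F. card (red P))"
    using finF card_red(2)[OF designD(1-3)[OF F] k] design_disjoint(1)[OF F] by (intro card_UN_disjoint) auto
  also have "\<dots> = card F * (2 * k ^ 2)"
    using card_red(1)[OF designD(1-3)[OF F] k] by simp
  finally have card: "card (?pr ` F) * (2 * k ^ 2) = n * (n - 1)" by (simp add: card_image[OF inj])
  have half: "2 * k - 1 \<le> card (A - C) + card (B - D)"
    if "card A = k" "card B = k" "card (A \<inter> C) + card (B \<inter> D) < 2" for A B C D :: "nat set"
  proof -
    have "finite A" "finite B" using that k by (auto intro: card_ge_0_finite)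
    then have "card (A - C) = k - card (A \<inter> C)" "card (B - D) = k - card (B \<inter> D)"
      using that by (simp_all add: card_Diff_subset_Int)
    with that(3) show ?thesis by linarith
  qed
  have "is_code n k (2 * k - 1) (?pr ` F)"
    unfolding is_code_def
  proof (intro conjI ballI impI)
    show "?pr ` F \<subseteq> disjoint_pairs n k"
    proof (rule image_subsetI)
      fix P assume "P \<in> F"
      with V[OF this] designD(1-3)[OF F this] show "?pr P \<in> disjoint_pairs n k"
        unfolding disjoint_pairs_def by blast
    qed
    fix X Y assume "X \<in> ?pr ` F" "Y \<in> ?pr ` F" and XY: "X \<noteq> Y"
    then obtain P Q where P: "P \<in> F" "X = ?pr P" and Q: "Q \<in> F" "Y = ?pr Q" by (elim imageE)
    with XY have ne: "P \<noteq> Q" by blast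
    obtain A B where AB: "P = (A, B)" by (cases P)
    obtain C D where CD: "Q = (C, D)" by (cases Q)
    note d = design_disjoint[OF F P(1) Q(1) ne]
    \<comment> \<open>The second term of the minimum is the first one for the block with its sides
      exchanged, which has the same colours.\<close>
    have swap: "red (D, C) = red Q" "blue (D, C) = blue Q" unfolding CD red_def blue_def by auto
    have "A \<inter> B = {}" "card A = k" "card B = k" "finite A" "finite B"
      using designD(1-3)[OF F P(1)] fin[OF P(1)] unfolding AB by auto
    moreover from this have "\<not> card (A \<inter> C) + card (B \<inter> D) \<ge> 2" "\<not> card (A \<inter> D) + card (B \<inter> C) \<ge> 2"
      using shared_pair[of A B C D] shared_pair[of A B D C] d swap unfolding AB CD by auto
    ultimately show "2 * k - 1 \<le> transport_dist X Y"
      unfolding P Q AB CD fst_conv snd_conv transport_dist_pair using half by simp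
  qed
  with card show ?thesis by blast
qed

text \<open>A red pair common to two members gives, under one of the two matchings, a common point
  on each side. That matching then costs at most \<open>2 * k - 2\<close>. Hence the red sets of a
  code are disjoint subsets of the complete graph, and counting gives the bound.\<close>

lemma code_size_le:
  assumes C: "is_code n k (2 * k - 1) C" and k: "k > 0"
  shows "card C * (2 * k ^ 2) \<le> n * (n - 1)"
proof -
  have C': "C \<subseteq> disjoint_pairs n k"
    and dist: "\<And>X Y. X \<in> C \<Longrightarrow> Y \<in> C \<Longrightarrow> X \<noteq> Y \<Longrightarrow> 2 * k - 1 \<le> transport_dist X Y"
    using C unfolding is_code_def by auto
  have "\<forall>X\<in>C. \<exists>P. X = {fst P, snd P} \<and> fst P \<subseteq> {1..n} \<and> snd P \<subseteq> {1..n} \<and>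
      card (fst P) = k \<and> card (snd P) = k \<and> fst P \<inter> snd P = {}"
  proof
    fix X assume "X \<in> C"
    with C' have "X \<in> disjoint_pairs n k" by (rule subsetD)
    then obtain A B where "X = {A, B}" "A \<subseteq> {1..n}" "B \<subseteq> {1..n}" "card A = k" "card B = k" "A \<inter> B = {}"
      unfolding disjoint_pairs_def by (elim CollectE exE conjE)
    then show "\<exists>P. X = {fst P, snd P} \<and> fst P \<subseteq> {1..n} \<and> snd P \<subseteq> {1..n} \<and>
      card (fst P) = k \<and> card (snd P) = k \<and> fst P \<inter> snd P = {}"
      by (intro exI[of _ "(A, B)"]) simp
  qed
  from bchoice[OF this] obtain p where p': "\<forall>X\<in>C. X = {fst (p X), snd (p X)} \<and>
      fst (p X) \<subseteq> {1..n} \<and> snd (p X) \<subseteq> {1..n} \<and>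
      card (fst (p X)) = k \<and> card (snd (p X)) = k \<and> fst (p X) \<inter> snd (p X) = {}" ..
  note p = bspec[OF p']
  have finC: "finite C" using C' finite_disjoint_pairs by (rule finite_subset)
  have far: False if "card A = k" "card B = k" "2 * k - 1 \<le> card (A - C) + card (B - D)"
      "x \<in> A \<inter> C" "y \<in> B \<inter> D" for A B C D :: "nat set" and x y
  proof -
    have fin: "finite A" "finite B" using that k by (auto intro: card_ge_0_finite)
    then have "card (A - C) = k - card (A \<inter> C)" "card (B - D) = k - card (B \<inter> D)"
      using that by (simp_all add: card_Diff_subset_Int)
    moreover have "card (A \<inter> C) \<ge> 1" "card (B \<inter> D) \<ge> 1"
      using that fin by (auto simp: Suc_le_eq card_gt_0_iff)
    ultimately show False using that(3) k by linarith
  qed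
  have disj: "red (p X) \<inter> red (p Y) = {}" if XY: "X \<in> C" "Y \<in> C" "X \<noteq> Y" for X Y
  proof (rule equals0I)
    fix e assume e: "e \<in> red (p X) \<inter> red (p Y)"
    obtain x y where xy: "e = (x, y)" by (cases e)
    let ?A = "fst (p X)" and ?B = "snd (p X)" and ?C = "fst (p Y)" and ?D = "snd (p Y)"
    have "2 * k - 1 \<le> transport_dist {?A, ?B} {?C, ?D}"
      using dist[OF XY] conjunct1[OF p[OF XY(1)]] conjunct1[OF p[OF XY(2)]] by simp
    then have d: "2 * k - 1 \<le> card (?A - ?C) + card (?B - ?D)" "2 * k - 1 \<le> card (?A - ?D) + card (?B - ?C)"
      unfolding transport_dist_pair by simp_all
    have c: "card ?A = k" "card ?B = k" using p[OF XY(1)] by simp_all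
    \<comment> \<open>Two matchings of the sides, each with two orientations of the ordered pair
      \<open>e\<close>.\<close>
    from e consider "x \<in> ?A \<inter> ?C" "y \<in> ?B \<inter> ?D" | "x \<in> ?A \<inter> ?D" "y \<in> ?B \<inter> ?C"
      | "y \<in> ?A \<inter> ?D" "x \<in> ?B \<inter> ?C" | "y \<in> ?A \<inter> ?C" "x \<in> ?B \<inter> ?D"
      unfolding xy red_def by auto
    then show False using far[OF c d(1)] far[OF c d(2)] by cases
  qed
  have "card C * (2 * k ^ 2) = (\<Sum>X\<in>C. card (red (p X)))"
  proof -
    have "card (red (p X)) = 2 * k ^ 2" if "X \<in> C" for X
      using p[OF that] k by (intro card_red) auto
    then show ?thesis by simp
  qed
  also have "\<dots> = card (\<Union>X\<in>C. red (p X))"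
  proof -
    have "finite (red (p X))" if "X \<in> C" for X using p[OF that] k card_red(2)[of "p X" k] by simp
    then show ?thesis using finC disj by (intro card_UN_disjoint[symmetric]) auto
  qed
  also have "\<dots> \<le> card (complete_graph {1..n})"
  proof (rule card_mono)
    show "finite (complete_graph {1..n})" unfolding complete_graph_def by simp
    have "red (p X) \<subseteq> complete_graph {1..n}" if "X \<in> C" for X
      using p[OF that] unfolding red_def complete_graph_def by blast
    then show "(\<Union>X\<in>C. red (p X)) \<subseteq> complete_graph {1..n}" by blast
  qed
  finally show ?thesis unfolding card_complete_graph .
qed

lemma max_code_of_decomposable:
  assumes "decomposable k (complete_graph {1..n})" and k: "k > 0"
  shows "max_code n k (2 * k - 1) * (2 * k ^ 2) = n * (n - 1)"
proof -
  obtain F where "design k (complete_graph {1..n}) F" using assms(1) unfolding decomposable_def by blast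
  from code_of_design[OF this k] obtain C where C: "is_code n k (2 * k - 1) C" "card C * (2 * k ^ 2) = n * (n - 1)"
    by blast
  have "max_code n k (2 * k - 1) = card C"
    unfolding max_code_def
  proof (rule Max_eqI[OF finite_code_sizes])
    fix c assume "c \<in> {card F | F. is_code n k (2 * k - 1) F}"
    then obtain C' where "is_code n k (2 * k - 1) C'" "c = card C'" by blast
    with code_size_le[OF this(1) k] C(2) have "c * (2 * k ^ 2) \<le> card C * (2 * k ^ 2)" by simp
    then show "c \<le> card C" using k by simp
  qed (use C in blast)
  with C(2) show ?thesis by simp
qed

section \<open>Difference families\<close>

text \<open>The group is the quotient of \<open>'g\<close> by \<open>L\<close>, with \<open>\<rho>\<close> choosing representatives.\<close>

lemma difference_family:
  fixes \<rho> :: "'g::ab_group_add \<Rightarrow> 'g" and \<beta> :: "'i \<Rightarrow> 'g set \<times> 'g set"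
  assumes \<rho>: "\<And>x y. \<rho> x = \<rho> y \<longleftrightarrow> x - y \<in> L" and idem: "\<And>x. \<rho> (\<rho> x) = \<rho> x"
    and D: "\<And>d e. d \<in> D \<Longrightarrow> d - e \<in> L \<Longrightarrow> e \<in> D" "0 \<notin> D"
    and size: "\<And>i. i \<in> I \<Longrightarrow> card (fst (\<beta> i)) = k \<and> card (snd (\<beta> i)) = k"
    and inD: "\<And>i a b. i \<in> I \<Longrightarrow> (a, b) \<in> red (\<beta> i) \<union> blue (\<beta> i) \<Longrightarrow> a - b \<in> D"
    and cover: "\<And>d. d \<in> D \<Longrightarrow> \<exists>i\<in>I. \<exists>(a, b)\<in>red (\<beta> i). d - (a - b) \<in> L"
    and red_once: "\<And>i j a b c d. i \<in> I \<Longrightarrow> j \<in> I \<Longrightarrow> (a, b) \<in> red (\<beta> i) \<Longrightarrow> (c, d) \<in> red (\<beta> j) \<Longrightarrow>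
        (a - b) - (c - d) \<in> L \<Longrightarrow> i = j \<and> a = c"
    and blue_once: "\<And>i j a b c d. i \<in> I \<Longrightarrow> j \<in> I \<Longrightarrow> (a, b) \<in> blue (\<beta> i) \<Longrightarrow> (c, d) \<in> blue (\<beta> j) \<Longrightarrow>
        (a - b) - (c - d) \<in> L \<Longrightarrow> i = j \<and> a = c"
  shows "decomposable k {(x, y). x \<in> range \<rho> \<and> y \<in> range \<rho> \<and> x - y \<in> D}"
proof -
  define \<tau> where "\<tau> g a = \<rho> (a + g)" for g a
  define blk where "blk g i = map_prod ((`) (\<tau> g)) ((`) (\<tau> g)) (\<beta> i)" for g i
  define E where "E = {(x, y). x \<in> range \<rho> \<and> y \<in> range \<rho> \<and> x - y \<in> D}"
  have L0: "0 \<in> L" using \<rho>[of 0 0] by simp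
  have Ldiff: "x - y \<in> L" if "x \<in> L" "y \<in> L" for x y
    using \<rho>[of x 0] \<rho>[of y 0] \<rho>[of x y] that by simp
  have Lneg: "- x \<in> L" if "x \<in> L" for x using Ldiff[OF L0 that] by simp
  have Ladd: "x + y \<in> L" if "x \<in> L" "y \<in> L" for x y using Ldiff[OF that(1) Lneg[OF that(2)]] by simp
  have \<rho>L: "\<rho> x - x \<in> L" for x using \<rho>[of "\<rho> x" x] idem by simp
  have \<tau>diff: "(\<tau> g a - \<tau> g b) - (a - b) \<in> L" for g a b
    using Ldiff[OF \<rho>L[of "a + g"] \<rho>L[of "b + g"]] unfolding \<tau>_def by (simp add: algebra_simps)
  \<comment> \<open>\<open>D\<close> is a union of cosets of \<open>L\<close> that omits
    \<open>0\<close>, so it misses \<open>L\<close>; this is what makes a translation injective on a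
    base block.\<close>
  have DL: "False" if "d \<in> D" "d \<in> L" for d using D(1)[of d 0] D(2) that by simp
  have inj: "inj_on (\<tau> g) (fst (\<beta> i) \<union> snd (\<beta> i))" if i: "i \<in> I" for g i
  proof (rule inj_onI)
    fix a b assume ab: "a \<in> fst (\<beta> i) \<union> snd (\<beta> i)" "b \<in> fst (\<beta> i) \<union> snd (\<beta> i)" "\<tau> g a = \<tau> g b"
    then have "a - b \<in> L" using \<rho>[of "a + g" "b + g"] unfolding \<tau>_def by simp
    moreover have "a - b \<in> D" if "a \<noteq> b"
      by (rule inD[OF i]) (use ab that in \<open>auto simp: red_def blue_def\<close>)
    ultimately show "a = b" using DL by blast
  qed
  have redb: "red (blk g i) = map_prod (\<tau> g) (\<tau> g) ` red (\<beta> i)" for g i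
    unfolding blk_def by (rule red_image)
  have blueb: "blue (blk g i) = map_prod (\<tau> g) (\<tau> g) ` blue (\<beta> i)" if "i \<in> I" for g i
    unfolding blk_def by (rule blue_image[OF inj[OF that]])
  have inE: "map_prod (\<tau> g) (\<tau> g) (a, b) \<in> E" if "i \<in> I" "(a, b) \<in> red (\<beta> i) \<union> blue (\<beta> i)" for g i a b
  proof -
    have "\<tau> g a - \<tau> g b \<in> D"
      by (rule D(1)[OF inD[OF that]]) (use Lneg[OF \<tau>diff[of g a b]] in \<open>simp add: algebra_simps\<close>)
    then show ?thesis unfolding E_def by (simp add: \<tau>_def)
  qed
  \<comment> \<open>A translation by a chosen representative is determined by where it sends a
    single point.\<close>
  have uniq: "g = h" if e: "\<tau> g a = \<tau> h a" and gh: "g \<in> range \<rho>" "h \<in> range \<rho>" for g h a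
  proof -
    have "g - h \<in> L" using e \<rho>[of "a + g" "a + h"] unfolding \<tau>_def by simp
    then have "\<rho> g = \<rho> h" using \<rho> by simp
    then show ?thesis using gh idem by auto
  qed
  \<comment> \<open>One argument for both colours: translating preserves differences modulo
    \<open>L\<close>, so a pair in two translates exhibits equal differences in the base blocks.
    These belong to the same base pair, and then the translations coincide.\<close>
  have once: "i = j \<and> g = h"
    if ij: "i \<in> I" "j \<in> I" and gh: "g \<in> range \<rho>" "h \<in> range \<rho>"
      and C: "C = red \<or> C = blue"
      and e: "e \<in> map_prod (\<tau> g) (\<tau> g) ` C (\<beta> i)" "e \<in> map_prod (\<tau> h) (\<tau> h) ` C (\<beta> j)" for i j g h e C
  proof -
    from e(1) obtain a b where ab: "(a, b) \<in> C (\<beta> i)" "e = (\<tau> g a, \<tau> g b)" by auto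
    from e(2) obtain c d where cd: "(c, d) \<in> C (\<beta> j)" "e = (\<tau> h c, \<tau> h d)" by auto
    from ab cd have eq: "\<tau> g a = \<tau> h c" "\<tau> g b = \<tau> h d" by auto
    have "(a - b) - (c - d) \<in> L"
      using Ldiff[OF \<tau>diff[of h c d] \<tau>diff[of g a b]] unfolding eq by (simp add: algebra_simps)
    then have "i = j \<and> a = c"
      using C ab cd red_once[OF ij] blue_once[OF ij] by blast
    with eq uniq[OF _ gh] show ?thesis by simp
  qed
  define F where "F = {blk g i | g i. g \<in> range \<rho> \<and> i \<in> I}"
  have "design k E F"
    unfolding design_def
  proof (intro conjI ballI impI)
    fix P assume "P \<in> F"
    then obtain g i where P: "P = blk g i" "i \<in> I" unfolding F_def by blast
    note inj = inj[OF P(2), of g]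
    have "inj_on (\<tau> g) (fst (\<beta> i))" "inj_on (\<tau> g) (snd (\<beta> i))"
      using inj by (auto intro: inj_on_subset)
    then show "card (fst P) = k" "card (snd P) = k"
      using size[OF P(2)] unfolding P(1) blk_def by (simp_all add: card_image)
    have "fst (\<beta> i) \<inter> snd (\<beta> i) = {}"
    proof (rule ccontr)
      assume "fst (\<beta> i) \<inter> snd (\<beta> i) \<noteq> {}"
      then obtain a where "(a, a) \<in> red (\<beta> i)" unfolding red_def by auto
      with inD[OF P(2), of a a] D(2) show False by simp
    qed
    then show "fst P \<inter> snd P = {}"
      using inj_on_image_Int[OF inj, of "fst (\<beta> i)" "snd (\<beta> i)"] unfolding P(1) blk_def by simp
    show "blue P \<subseteq> E"
      unfolding P(1) blueb[OF P(2)] using inE[OF P(2)] by auto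
  next
    show "(\<Union>P\<in>F. red P) = E"
    proof
      show "(\<Union>P\<in>F. red P) \<subseteq> E"
      proof (rule UN_least)
        fix P assume "P \<in> F"
        then obtain g i where P: "P = blk g i" "i \<in> I" unfolding F_def by blast
        show "red P \<subseteq> E" unfolding P(1) redb using inE[OF P(2)] by auto
      qed
      show "E \<subseteq> (\<Union>P\<in>F. red P)"
      proof
        fix e assume "e \<in> E"
        then obtain x y where e: "e = (x, y)" "x \<in> range \<rho>" "y \<in> range \<rho>" "x - y \<in> D"
          unfolding E_def by blast
        from cover[OF e(4)] obtain i a b where i: "i \<in> I" "(a, b) \<in> red (\<beta> i)" "(x - y) - (a - b) \<in> L"
          by blast
        \<comment> \<open>The translation is chosen to carry \<open>a\<close> to \<open>x\<close>;
          agreement of the differences modulo \<open>L\<close> then carries \<open>b\<close> to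
          \<open>y\<close>.\<close>
        define g where "g = \<rho> (x - a)"
        have gL: "g - (x - a) \<in> L" unfolding g_def by (rule \<rho>L)
        have x: "\<tau> g a = x"
        proof -
          have "(a + g) - x \<in> L" using gL by (simp add: algebra_simps)
          then have "\<rho> (a + g) = \<rho> x" using \<rho> by simp
          then show ?thesis using e(2) idem unfolding \<tau>_def by auto
        qed
        have y: "\<tau> g b = y"
        proof -
          have "(b + g) - y \<in> L" using Ladd[OF gL i(3)] by (simp add: algebra_simps)
          then have "\<rho> (b + g) = \<rho> y" using \<rho> by simp
          then show ?thesis using e(3) idem unfolding \<tau>_def by auto
        qed
        have "map_prod (\<tau> g) (\<tau> g) (a, b) \<in> red (blk g i)" unfolding redb by (rule imageI[OF i(2)])
        moreover have "blk g i \<in> F" unfolding F_def g_def using i(1) by blast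
        ultimately show "e \<in> (\<Union>P\<in>F. red P)" unfolding e(1) using x y by auto
      qed
    qed
  next
    fix P Q assume "P \<in> F" "Q \<in> F" and ne: "P \<noteq> Q"
    then obtain g i h j where P: "P = blk g i" "i \<in> I" "g \<in> range \<rho>" and Q: "Q = blk h j" "j \<in> I" "h \<in> range \<rho>"
      unfolding F_def by blast
    with ne have ne': "\<not> (i = j \<and> g = h)" by blast
    note o = once[OF P(2) Q(2) P(3) Q(3)]
    show "red P \<inter> red Q = {}"
    proof (rule equals0I)
      fix e assume "e \<in> red P \<inter> red Q"
      then have "i = j \<and> g = h"
        unfolding P(1) Q(1) redb by (intro o[of red e]) simp_all
      with ne' show False by simp
    qed
    show "blue P \<inter> blue Q = {}"
    proof (rule equals0I)
      fix e assume "e \<in> blue P \<inter> blue Q"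
      then have "i = j \<and> g = h"
        unfolding P(1) Q(1) blueb[OF P(2)] blueb[OF Q(2)] by (intro o[of blue e]) simp_all
      with ne' show False by simp
    qed
  qed
  then show ?thesis unfolding decomposable_def E_def by blast
qed

section \<open>Executable certificates for difference families over cyclic groups\<close>

definition red_pairs :: "'g list \<times> 'g list \<Rightarrow> ('g \<times> 'g) list" where
  "red_pairs S = List.product (fst S) (snd S) @ List.product (snd S) (fst S)"

definition blue_pairs :: "'g list \<times> 'g list \<Rightarrow> ('g \<times> 'g) list" where
  "blue_pairs S = filter (\<lambda>(a, b). a \<noteq> b)
     (List.product (fst S) (fst S) @ List.product (snd S) (snd S))"

lemma set_red_pairs: "set (red_pairs S) = red (set (fst S), set (snd S))"
  by (auto simp: red_pairs_def red_def)

lemma set_blue_pairs: "set (blue_pairs S) = blue (set (fst S), set (snd S))"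
  by (auto simp: blue_pairs_def blue_def)

text \<open>Each pair is tagged with its block, so that \<open>distinct\<close> on a list of
  differences identifies the block as well as the points.\<close>

definition index_pairs :: "('s \<Rightarrow> ('g \<times> 'g) list) \<Rightarrow> 's list \<Rightarrow> ('s \<times> 'g \<times> 'g) list" where
  "index_pairs f Ss = concat (map (\<lambda>S. map (Pair S) (f S)) Ss)"

lemma set_index_pairs: "(S, p) \<in> set (index_pairs f Ss) \<longleftrightarrow> S \<in> set Ss \<and> p \<in> set (f S)"
  by (auto simp: index_pairs_def)

definition sized :: "nat \<Rightarrow> ('g list \<times> 'g list) list \<Rightarrow> bool" where
  "sized k Ss \<longleftrightarrow> (\<forall>S\<in>set Ss. distinct (fst S) \<and> distinct (snd S) \<and> length (fst S) = k \<and> length (snd S) = k)"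

definition cyclic_diffs :: "(int list \<times> int list \<Rightarrow> (int \<times> int) list) \<Rightarrow> int \<Rightarrow> (int list \<times> int list) list \<Rightarrow> int list" where
  "cyclic_diffs f v Ss = map (\<lambda>(S, a, b). (a - b) mod v) (index_pairs f Ss)"

lemma cyclic_diffs_mem:
  assumes "S \<in> set Ss" "(a, b) \<in> set (f S)"
  shows "(a - b) mod v \<in> set (cyclic_diffs f v Ss)"
proof -
  have "(S, a, b) \<in> set (index_pairs f Ss)" using assms by (simp add: set_index_pairs)
  then have "(\<lambda>(S, a, b). (a - b) mod v) (S, a, b) \<in> set (cyclic_diffs f v Ss)"
    unfolding cyclic_diffs_def set_map by (rule imageI)
  then show ?thesis by simp
qed

lemma cyclic_diffs_once:
  assumes "distinct (cyclic_diffs f v Ss)" "S \<in> set Ss" "T \<in> set Ss" "(a, b) \<in> set (f S)" "(c, d) \<in> set (f T)"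
    "v dvd (a - b) - (c - d)"
  shows "S = T \<and> a = c"
proof -
  have "inj_on (\<lambda>(S, a, b). (a - b) mod v) (set (index_pairs f Ss))"
    using assms(1) unfolding cyclic_diffs_def by (simp add: distinct_map)
  moreover have "(a - b) mod v = (c - d) mod v" using assms(6) by (simp add: mod_eq_dvd_iff)
  ultimately have "(S, a, b) = (T, c, d)"
    using assms(2-5) by (elim inj_onD) (simp_all add: set_index_pairs)
  then show ?thesis by simp
qed

text \<open>The residue classes modulo \<open>h\<close> become the parts of a multipartite graph on
  the integers modulo \<open>v\<close>; for \<open>h = v\<close> the graph is complete. Red
  differences hit every nonmultiple of \<open>h\<close> exactly once, and blue ones at most once.
  Everything is phrased with lists so that it can be evaluated.\<close>

definition cyclic_certificate :: "nat \<Rightarrow> int \<Rightarrow> int \<Rightarrow> (int list \<times> int list) list \<Rightarrow> bool" where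
  "cyclic_certificate k h v Ss \<longleftrightarrow> sized k Ss \<and>
     distinct (cyclic_diffs red_pairs v Ss) \<and>
     set (cyclic_diffs red_pairs v Ss) = set (filter (\<lambda>d. d mod h \<noteq> 0) [0..v - 1]) \<and>
     distinct (cyclic_diffs blue_pairs v Ss) \<and>
     (\<forall>d\<in>set (cyclic_diffs blue_pairs v Ss). d mod h \<noteq> 0)"

lemma cyclic_difference_family:
  fixes v h :: int
  assumes cert: "cyclic_certificate k h v Ss" and "h dvd v" and v: "v > 0"
  shows "decomposable k {(x, y). x \<in> {0..<v} \<and> y \<in> {0..<v} \<and> \<not> h dvd x - y}"
proof -
  have "sized k Ss"
    and red: "distinct (cyclic_diffs red_pairs v Ss)"
      "set (cyclic_diffs red_pairs v Ss) = set (filter (\<lambda>d. d mod h \<noteq> 0) [0..v - 1])"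
    and blue: "distinct (cyclic_diffs blue_pairs v Ss)"
      "\<forall>d\<in>set (cyclic_diffs blue_pairs v Ss). d mod h \<noteq> 0"
    using cert by (simp_all add: cyclic_certificate_def)
  define D where "D = {d. \<not> h dvd d}"
  define \<beta> where "\<beta> S = (set (fst S), set (snd S))" for S :: "int list \<times> int list"
  have range: "range (\<lambda>x. x mod v) = {0..<v}"
  proof
    show "range (\<lambda>x. x mod v) \<subseteq> {0..<v}" using v by auto
    show "{0..<v} \<subseteq> range (\<lambda>x. x mod v)" by (metis atLeastLessThan_iff mod_pos_pos_trivial rangeI subsetI)
  qed
  have modh: "d mod v mod h = d mod h" for d using \<open>h dvd v\<close> by (simp add: mod_mod_cancel)
  have "decomposable k {(x, y). x \<in> range (\<lambda>x. x mod v) \<and> y \<in> range (\<lambda>x. x mod v) \<and> x - y \<in> D}"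
  proof (rule difference_family[where L = "{x. v dvd x}" and I = "set Ss" and \<beta> = \<beta>])
    fix x y show "(x mod v = y mod v) = (x - y \<in> {x. v dvd x})" by (simp add: mod_eq_dvd_iff)
  next
    fix d e assume "d \<in> D" "d - e \<in> {x. v dvd x}"
    then show "e \<in> D" unfolding D_def using \<open>h dvd v\<close>
      by (metis dvd_diff_commute dvd_diff_right_iff dvd_trans mem_Collect_eq)
  next
    fix S assume "S \<in> set Ss"
    then show "card (fst (\<beta> S)) = k \<and> card (snd (\<beta> S)) = k"
      using \<open>sized k Ss\<close> unfolding sized_def \<beta>_def by (simp add: distinct_card)
  next
    fix S a b assume S: "S \<in> set Ss" and ab: "(a, b) \<in> red (\<beta> S) \<union> blue (\<beta> S)"
    have "(a - b) mod v \<in> set (cyclic_diffs red_pairs v Ss) \<union> set (cyclic_diffs blue_pairs v Ss)"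
      using S ab unfolding \<beta>_def set_red_pairs[symmetric] set_blue_pairs[symmetric]
      by (auto intro: cyclic_diffs_mem)
    then have "(a - b) mod v mod h \<noteq> 0" using red(2) blue(2) by auto
    then show "a - b \<in> D" unfolding D_def modh by (simp add: dvd_eq_mod_eq_0)
  next
    fix d assume "d \<in> D"
    then have "d mod v mod h \<noteq> 0" unfolding D_def modh by (simp add: dvd_eq_mod_eq_0)
    then have "d mod v \<in> set (cyclic_diffs red_pairs v Ss)" unfolding red(2) using v by simp
    then obtain S a b where "S \<in> set Ss" "(a, b) \<in> set (red_pairs S)" "d mod v = (a - b) mod v"
      unfolding cyclic_diffs_def by (auto simp: set_index_pairs)
    then show "\<exists>S\<in>set Ss. \<exists>(a, b)\<in>red (\<beta> S). d - (a - b) \<in> {x. v dvd x}"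
      unfolding \<beta>_def set_red_pairs mod_eq_dvd_iff by blast
  qed (use cyclic_diffs_once[OF red(1)] cyclic_diffs_once[OF blue(1)] in
      \<open>auto simp: D_def \<beta>_def set_red_pairs set_blue_pairs\<close>)
  then show ?thesis unfolding range D_def by simp
qed

text \<open>The residue modulo \<open>h\<close> names the part and the quotient by \<open>h\<close>
  the position inside it. This is a mere relabelling of vertices after the decomposition is found,
  so \<open>h\<close> and \<open>w\<close> may have common factors.\<close>

lemma decomposable_multipartite_cyclic:
  assumes cert: "cyclic_certificate k (int h) (int (h * w)) Ss" and "k > 0" "h > 0" "w > 0"
  shows "decomposable k (multipartite {..<h} w)"
proof -
  let ?E = "{(x, y). x \<in> {0..<int (h * w)} \<and> y \<in> {0..<int (h * w)} \<and> \<not> int h dvd x - y}"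
  have dec: "decomposable k ?E"
    by (rule cyclic_difference_family[OF cert]) (use assms in simp_all)
  let ?f = "\<lambda>x. (nat (x mod int h), nat (x div int h))"
  have "map_prod ?f ?f ` ?E = multipartite {..<h} w"
  proof
    show "map_prod ?f ?f ` ?E \<subseteq> multipartite {..<h} w"
    proof (rule image_subsetI)
      fix e assume "e \<in> ?E"
      then obtain x y where e: "e = (x, y)" and x: "x \<in> {0..<int (h * w)}"
        and y: "y \<in> {0..<int (h * w)}" and n: "\<not> int h dvd x - y" by blast
      have "z div int h < int w" if "z \<in> {0..<int (h * w)}" for z
      proof (rule ccontr)
        assume "\<not> z div int h < int w"
        then have "int h * int w \<le> int h * (z div int h)" by (intro mult_left_mono) auto
        also have "\<dots> \<le> z" using \<open>h > 0\<close> by (simp add: minus_mod_eq_mult_div[symmetric])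
        finally show False using that by simp
      qed
      moreover have "x mod int h \<noteq> y mod int h" using n by (simp add: mod_eq_dvd_iff)
      ultimately show "map_prod ?f ?f e \<in> multipartite {..<h} w"
        using x y \<open>h > 0\<close> unfolding multipartite_def e
        by (auto simp: nat_less_iff pos_imp_zdiv_nonneg_iff eq_nat_nat_iff)
    qed
    show "multipartite {..<h} w \<subseteq> map_prod ?f ?f ` ?E"
    proof
      fix e assume "e \<in> multipartite {..<h} w"
      then obtain a i b j where e: "e = ((a, i), (b, j))" "a < h" "b < h" "a \<noteq> b" "i < w" "j < w"
        unfolding multipartite_def by auto
      have in_range: "int (c + h * l) \<in> {0..<int (h * w)}" if "c < h" "l < w" for c l
      proof -
        have "c + h * l < h * Suc l" using that by simp
        also have "\<dots> \<le> h * w" using that by (intro mult_le_mono) auto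
        finally show ?thesis unfolding atLeastLessThan_iff of_nat_less_iff by simp
      qed
      have f: "?f (int (c + h * l)) = (c, l)" if "c < h" for c l
        using that by (simp flip: of_nat_mod of_nat_div)
      have "\<not> int h dvd int (a + h * i) - int (b + h * j)"
        using f[OF e(2), of i] f[OF e(3), of j] e(4) unfolding mod_eq_dvd_iff[symmetric] by auto
      then have "(int (a + h * i), int (b + h * j)) \<in> ?E" using in_range e by auto
      then have "map_prod ?f ?f (int (a + h * i), int (b + h * j)) \<in> map_prod ?f ?f ` ?E" by (rule imageI)
      then show "e \<in> map_prod ?f ?f ` ?E" unfolding map_prod_simp f[OF e(2)] f[OF e(3)] e(1) .
    qed
  qed
  moreover have "decomposable k (map_prod ?f ?f ` ?E)"
  proof (rule decomposable_image[OF dec])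
    show "?E \<subseteq> {0..<int (h * w)} \<times> {0..<int (h * w)}" by auto
    show "inj_on ?f {0..<int (h * w)}"
    proof (rule inj_onI)
      fix x y assume x: "x \<in> {0..<int (h * w)}" and y: "y \<in> {0..<int (h * w)}" and e: "?f x = ?f y"
      then have "x mod int h = y mod int h" "x div int h = y div int h"
        using \<open>h > 0\<close> by (auto simp: eq_nat_nat_iff pos_imp_zdiv_nonneg_iff)
      then show "x = y" by (metis div_mult_mod_eq)
    qed
  qed fact
  ultimately show ?thesis by simp
qed


lemma decomposable_complete_cyclic:
  assumes cert: "cyclic_certificate k (int n) (int n) Ss" and "k > 0" "n > 0"
  shows "decomposable k (complete_graph {..<n})"
proof -
  have "x = y" if "x \<in> {0..<int n}" "y \<in> {0..<int n}" "int n dvd x - y" for x y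
    using that unfolding mod_eq_dvd_iff[symmetric] by simp
  then have "{(x, y). x \<in> {0..<int n} \<and> y \<in> {0..<int n} \<and> \<not> int n dvd x - y} = complete_graph {0..<int n}"
    unfolding complete_graph_def by auto
  moreover have "decomposable k {(x, y). x \<in> {0..<int n} \<and> y \<in> {0..<int n} \<and> \<not> int n dvd x - y}"
    by (rule cyclic_difference_family[OF cert]) (use assms in simp_all)
  ultimately have "decomposable k (complete_graph {0..<int n})" by simp
  then show ?thesis by (rule decomposable_complete_transfer) (use assms in simp_all)
qed


section \<open>Difference families with a scaled first coordinate\<close>

definition scaled_diffs ::
  "((int \<times> int) list \<times> (int \<times> int) list \<Rightarrow> ((int \<times> int) \<times> (int \<times> int)) list) \<Rightarrow> int \<Rightarrow>
    ((int \<times> int) list \<times> (int \<times> int) list) list \<Rightarrow> (int \<times> int) list" where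
  "scaled_diffs f w Ss = map (\<lambda>(S, p, q). (fst p - fst q, (snd p - snd q) mod w)) (index_pairs f Ss)"

text \<open>Multipliers \<open>m\<close> and \<open>- m\<close> may share a level difference: for \<open>0 < x < N / 2\<close> the multiples \<open>m x\<close> and
  \<open>- m x\<close> together meet every nonzero residue modulo \<open>N\<close> exactly once. Since \<open>m\<close> divides \<open>30\<^sup>2\<close>, it is
  invertible.\<close>

definition balanced_diffs :: "(int \<times> int) list \<Rightarrow> bool" where
  "balanced_diffs G \<longleftrightarrow> distinct G \<and> (\<forall>(m, d)\<in>set G. m \<in> {-6..6} - {0} \<and>
     (\<forall>(m', d')\<in>set G. d = d' \<longrightarrow> m' = m \<or> m' = - m))"

lemma scaled_diffs_mem:
  assumes "S \<in> set Ss" "(p, q) \<in> set (f S)"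
  shows "(fst p - fst q, (snd p - snd q) mod w) \<in> set (scaled_diffs f w Ss)"
proof -
  have "(S, p, q) \<in> set (index_pairs f Ss)" using assms by (simp add: set_index_pairs)
  then have "(\<lambda>(S, p, q). (fst p - fst q, (snd p - snd q) mod w)) (S, p, q) \<in> set (scaled_diffs f w Ss)"
    unfolding scaled_diffs_def set_map by (rule imageI)
  then show ?thesis by simp
qed

lemma coprime_small:
  fixes N m :: int
  assumes "coprime N 30" "m \<in> {-6..6} - {0}"
  shows "coprime N m"
proof -
  have "m = -6 \<or> m = -5 \<or> m = -4 \<or> m = -3 \<or> m = -2 \<or> m = -1 \<or>
      m = 6 \<or> m = 5 \<or> m = 4 \<or> m = 3 \<or> m = 2 \<or> m = 1"
    using assms(2) unfolding Diff_iff atLeastAtMost_iff singleton_iff by presburger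
  then have "m dvd 30 ^ 2" by (elim disjE) simp_all
  moreover have "coprime N (30 ^ 2)" using assms(1) unfolding coprime_power_right_iff by simp
  ultimately show ?thesis using coprime_divisors[of N N m "30 ^ 2"] by simp
qed

text \<open>Equal level differences force multipliers \<open>m\<close> and \<open>m\<close> or
  \<open>m\<close> and \<open>- m\<close>. In the first case \<open>N\<close> divides
  \<open>m * (x - y)\<close>, so \<open>x = y\<close>; in the second \<open>N\<close> divides
  \<open>m * (x + y)\<close>, impossible since \<open>0 < x + y < N\<close>. With scale and
  multiplier equal, distinctness of the certificate identifies the pairs.\<close>

lemma scaled_diffs_once:
  fixes N w x y :: int
  assumes bal: "balanced_diffs (scaled_diffs f w Ss)" and N: "coprime N 30"
    and x: "x \<in> {0<..<N}" "2 * x < N" and y: "y \<in> {0<..<N}" "2 * y < N"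
    and S: "S \<in> set Ss" "T \<in> set Ss" and pq: "(p, q) \<in> set (f S)" and rs: "(r, s) \<in> set (f T)"
    and dvd: "N dvd (fst p - fst q) * x - (fst r - fst s) * y" "w dvd (snd p - snd q) - (snd r - snd s)"
  shows "x = y \<and> S = T \<and> p = r \<and> q = s"
proof -
  let ?g = "\<lambda>(S, p, q). (fst p - fst q, (snd p - snd q) mod w)"
  let ?m = "fst p - fst q" and ?m' = "fst r - fst s"
  have inj: "inj_on ?g (set (index_pairs f Ss))"
    using bal unfolding balanced_diffs_def scaled_diffs_def by (simp add: distinct_map)
  have "(snd p - snd q) mod w = (snd r - snd s) mod w" using dvd(2) by (simp add: mod_eq_dvd_iff)
  note eq = this
  have "?m \<in> {-6..6} - {0}" "?m' = ?m \<or> ?m' = - ?m"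
    using bal scaled_diffs_mem[of S Ss p q f w, OF S(1) pq] scaled_diffs_mem[of T Ss r s f w, OF S(2) rs] eq
    unfolding balanced_diffs_def by fastforce+
  then have cop: "coprime N ?m" and "?m' = ?m \<or> ?m' = - ?m"
    using coprime_small[OF N] by blast+
  from this(2) have m: "?m' = ?m" and "x = y"
  proof -
    have *: "?m' = ?m \<and> x = y"
    proof (cases "?m' = ?m")
      case True
      have e: "?m * x - ?m' * y = ?m * (x - y)" unfolding True by (simp only: right_diff_distrib)
      have "N dvd ?m * (x - y)" using dvd(1) unfolding e .
      with cop have "N dvd x - y" by (simp add: coprime_dvd_mult_right_iff)
      then have "x mod N = y mod N" by (simp add: mod_eq_dvd_iff)
      then have "x = y" using x y by simp
      with True show ?thesis by simp
    next
      case False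
      with \<open>?m' = ?m \<or> ?m' = - ?m\<close> have "?m' = - ?m" by simp
      then have e: "?m * x - ?m' * y = ?m * (x + y)" unfolding \<open>?m' = - ?m\<close> by (simp add: algebra_simps)
      have "N dvd ?m * (x + y)" using dvd(1) unfolding e .
      with cop have "N dvd x + y" by (simp add: coprime_dvd_mult_right_iff)
      then have "N \<le> x + y" using x y by (intro zdvd_imp_le) auto
      with x y show ?thesis by simp
    qed
    then show "?m' = ?m" "x = y" by auto
  qed
  have "?g (S, p, q) = ?g (T, r, s)" using m eq by simp
  then have "(S, p, q) = (T, r, s)"
    using S pq rs by (intro inj_onD[OF inj]) (simp_all add: set_index_pairs)
  with \<open>x = y\<close> show ?thesis by simp
qed

text \<open>First coordinates stay unreduced and \<open>N\<close> does not occur, so one certificate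
  serves all \<open>N\<close> coprime to \<open>30\<close>. Each level \<open>d\<close>, including
  \<open>0\<close>, must carry both \<open>m\<close> and \<open>- m\<close>. For two blocks and
  \<open>w = 2 * k ^ 2\<close> the \<open>4 * k ^ 2\<close> ordered red differences are just enough
  for two multipliers per level.\<close>

definition scaled_certificate :: "nat \<Rightarrow> int \<Rightarrow> ((int \<times> int) list \<times> (int \<times> int) list) list \<Rightarrow> bool" where
  "scaled_certificate k w Ss \<longleftrightarrow> sized k Ss \<and>
     balanced_diffs (scaled_diffs red_pairs w Ss) \<and>
     (\<forall>d\<in>{0..<w}. \<exists>(m, d')\<in>set (scaled_diffs red_pairs w Ss).
        d = d' \<and> (- m, d) \<in> set (scaled_diffs red_pairs w Ss)) \<and>
     balanced_diffs (scaled_diffs blue_pairs w Ss)"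

lemma scaled_difference_family:
  fixes N w :: int
  assumes cert: "scaled_certificate k w Ss" and N: "N > 0" "coprime N 30" and w: "w > 0"
  shows "decomposable k {((a, i), (b, j)). a \<in> {0..<N} \<and> b \<in> {0..<N} \<and> i \<in> {0..<w} \<and> j \<in> {0..<w} \<and> a \<noteq> b}"
proof -
  have sized: "sized k Ss"
    and red: "balanced_diffs (scaled_diffs red_pairs w Ss)"
      "\<forall>d\<in>{0..<w}. \<exists>(m, d')\<in>set (scaled_diffs red_pairs w Ss).
         d = d' \<and> (- m, d) \<in> set (scaled_diffs red_pairs w Ss)"
    and blue: "balanced_diffs (scaled_diffs blue_pairs w Ss)"
    using cert unfolding scaled_certificate_def by blast+
  define \<rho> where "\<rho> = (\<lambda>(a, i). (a mod N, i mod w))"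
  define L where "L = {(a, i). N dvd a \<and> w dvd i}"
  define D where "D = {(a, i :: int). \<not> N dvd a}"
  define H where "H = {x. 0 < x \<and> 2 * x < N}"
  define sc where "sc x p = (fst p * x, snd p)" for x and p :: "int \<times> int"
  define \<beta> where "\<beta> = (\<lambda>(x, S). map_prod ((`) (sc x)) ((`) (sc x)) (set (fst S), set (snd S)))"
  have range: "range \<rho> = {0..<N} \<times> {0..<w}"
  proof
    show "range \<rho> \<subseteq> {0..<N} \<times> {0..<w}" using N w by (auto simp: \<rho>_def)
    show "{0..<N} \<times> {0..<w} \<subseteq> range \<rho>"
    proof
      fix p assume "p \<in> {0..<N} \<times> {0..<w}"
      then have "p = \<rho> p" by (auto simp: \<rho>_def)
      then show "p \<in> range \<rho>" by (rule range_eqI)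
    qed
  qed
  have sc_inj: "inj (sc x)" if "x \<in> H" for x
    using that by (auto simp: inj_def sc_def H_def)
  have redb: "red (\<beta> (x, S)) = map_prod (sc x) (sc x) ` set (red_pairs S)" for x S
    unfolding \<beta>_def set_red_pairs by (simp add: red_image[of "sc x" "(set (fst S), set (snd S))", simplified])
  have blueb: "blue (\<beta> (x, S)) = map_prod (sc x) (sc x) ` set (blue_pairs S)" if "x \<in> H" for x S
    using blue_image[of "sc x" "(set (fst S), set (snd S))"] inj_on_subset[OF sc_inj[OF that]]
    unfolding \<beta>_def set_blue_pairs by simp
  have inD: "sc x p - sc x q \<in> D"
    if "balanced_diffs (scaled_diffs f w Ss)" "x \<in> H" "S \<in> set Ss" "(p, q) \<in> set (f S)" for f x S p q
  proof -
    have "fst p - fst q \<in> {-6..6} - {0}"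
      using that(1) scaled_diffs_mem[of S Ss p q f w, OF that(3,4)] unfolding balanced_diffs_def by blast
    then have "coprime N (fst p - fst q)" by (rule coprime_small[OF N(2)])
    moreover have "\<not> N dvd x" using that(2) zdvd_imp_le[of N x] unfolding H_def by auto
    ultimately have "\<not> N dvd (fst p - fst q) * x" by (simp add: coprime_dvd_mult_right_iff)
    then show ?thesis unfolding D_def sc_def by (simp add: algebra_simps)
  qed
  have once: "(x, S) = (y, T) \<and> a = c"
    if "balanced_diffs (scaled_diffs f w Ss)" "x \<in> H" "S \<in> set Ss" "y \<in> H" "T \<in> set Ss"
      and ab: "(a, b) \<in> map_prod (sc x) (sc x) ` set (f S)"
      and cd: "(c, d) \<in> map_prod (sc y) (sc y) ` set (f T)" and L: "(a - b) - (c - d) \<in> L"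
    for f x S y T a b c d
  proof -
    from ab obtain p q where pq: "(p, q) \<in> set (f S)" "a = sc x p" "b = sc x q" by auto
    from cd obtain r s where rs: "(r, s) \<in> set (f T)" "c = sc y r" "d = sc y s" by auto
    have "x = y \<and> S = T \<and> p = r \<and> q = s"
      by (rule scaled_diffs_once[OF that(1) N(2) _ _ _ _ that(3,5) pq(1) rs(1)])
        (use that(2,4) L in \<open>auto simp: H_def pq rs L_def sc_def algebra_simps\<close>)
    with pq rs show ?thesis by simp
  qed
  have "decomposable k {(p, q). p \<in> range \<rho> \<and> q \<in> range \<rho> \<and> p - q \<in> D}"
  proof (rule difference_family[where L = L and I = "H \<times> set Ss" and \<beta> = \<beta>])
    fix p q show "(\<rho> p = \<rho> q) = (p - q \<in> L)"
      unfolding \<rho>_def L_def by (cases p; cases q) (simp add: mod_eq_dvd_iff)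
    show "\<rho> (\<rho> p) = \<rho> p" unfolding \<rho>_def by (cases p) simp
  next
    fix d e assume "d \<in> D" "d - e \<in> L"
    then show "e \<in> D" unfolding D_def L_def
      by (cases d; cases e) (metis (mono_tags, lifting) case_prod_conv diff_Pair dvd_diff_right_iff dvd_diff_commute mem_Collect_eq)
  next
    show "0 \<notin> D" unfolding D_def zero_prod_def by simp
  next
    fix i assume "i \<in> H \<times> set Ss"
    then obtain x S where i: "i = (x, S)" "x \<in> H" "S \<in> set Ss" by auto
    then show "card (fst (\<beta> i)) = k \<and> card (snd (\<beta> i)) = k"
      using sized inj_on_subset[OF sc_inj[OF i(2)]] unfolding sized_def \<beta>_def
      by (simp add: distinct_card card_image)
  next
    fix i a b assume "i \<in> H \<times> set Ss" and ab: "(a, b) \<in> red (\<beta> i) \<union> blue (\<beta> i)"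
    then obtain x S where i: "i = (x, S)" "x \<in> H" "S \<in> set Ss" by auto
    from ab show "a - b \<in> D" unfolding i(1) redb blueb[OF i(2)]
      using inD[OF red(1) i(2,3)] inD[OF blue i(2,3)] by auto
  next
    fix d assume "d \<in> D"
    then obtain e \<delta> where d: "d = (e, \<delta>)" "\<not> N dvd e" unfolding D_def by auto
    have "\<delta> mod w \<in> {0..<w}" using w by simp
    with red(2) obtain m where m: "(m, \<delta> mod w) \<in> set (scaled_diffs red_pairs w Ss)"
      "(- m, \<delta> mod w) \<in> set (scaled_diffs red_pairs w Ss)" by blast
    have "m \<in> {-6..6} - {0}" using red(1) m(1) unfolding balanced_diffs_def by blast
    then have "coprime N m" by (rule coprime_small[OF N(2)])
    \<comment> \<open>To realise the first coordinate \<open>e\<close>, solve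
      \<open>m * y = e\<close> modulo \<open>N\<close> with the inverse \<open>t\<close> of
      \<open>m\<close>.\<close>
    then obtain t where "[m * t = 1] (mod N)"
      using cong_solve_coprime_int[of m N] by (auto simp: coprime_commute)
    then have t: "N dvd m * (t * e) - e"
      using cong_scalar_right[of "m * t" 1 N e] by (simp add: cong_iff_dvd_diff algebra_simps)
    define y where "y = t * e mod N"
    have "N dvd t * e - y" unfolding y_def by (simp add: minus_mod_eq_mult_div)
    then have "N dvd m * (t * e) - m * y" by (metis dvd_mult right_diff_distrib)
    with t have my: "N dvd e - m * y" by (metis (no_types, lifting) diff_diff_eq2 dvd_diff dvd_diff_commute add_diff_cancel_left' diff_add_cancel)
    have y: "0 < y" "y < N"
    proof -
      have "y \<noteq> 0" using my d(2) by auto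
      moreover have "0 \<le> y" "y < N" unfolding y_def using N by auto
      ultimately show "0 < y" "y < N" by auto
    qed
    \<comment> \<open>\<open>N\<close> is odd, so exactly one of \<open>y\<close> and
      \<open>N - y\<close> lies below \<open>N / 2\<close>. In the latter case the multiplier
      \<open>- m\<close> takes over.\<close>
    have odd: "2 * y \<noteq> N" using N(2) by auto
    obtain x m' where x: "x \<in> H" "(m', \<delta> mod w) \<in> set (scaled_diffs red_pairs w Ss)" "N dvd e - m' * x"
    proof (cases "2 * y < N")
      case True
      then show ?thesis using that[of y m] m my y unfolding H_def by simp
    next
      case False
      have eq: "e - - m * (N - y) = (e - m * y) + m * N" by (simp add: algebra_simps)
      have "N dvd e - - m * (N - y)" unfolding eq using my by simp
      with False show ?thesis using that[of "N - y" "- m"] m y odd unfolding H_def by auto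
    qed
    from x(2) obtain S p q where S: "S \<in> set Ss" "(p, q) \<in> set (red_pairs S)" "m' = fst p - fst q"
      "\<delta> mod w = (snd p - snd q) mod w"
      unfolding scaled_diffs_def by (auto simp: set_index_pairs)
    have "d - (sc x p - sc x q) \<in> L"
      using x(3) S(3,4) unfolding d(1) L_def sc_def by (simp add: mod_eq_dvd_iff algebra_simps)
    moreover have "(sc x p, sc x q) \<in> red (\<beta> (x, S))" unfolding redb using S(2) by force
    ultimately show "\<exists>i\<in>H \<times> set Ss. \<exists>(a, b)\<in>red (\<beta> i). d - (a - b) \<in> L"
      using x(1) S(1) by blast
  next
    fix i j a b c d assume "i \<in> H \<times> set Ss" "j \<in> H \<times> set Ss"
      and ab: "(a, b) \<in> red (\<beta> i)" "(c, d) \<in> red (\<beta> j)" "a - b - (c - d) \<in> L"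
    then obtain x S y T where ij: "i = (x, S)" "x \<in> H" "S \<in> set Ss" "j = (y, T)" "y \<in> H" "T \<in> set Ss" by auto
    show "i = j \<and> a = c"
      using once[OF red(1) ij(2,3,5,6) _ _ ab(3)] ab(1,2) unfolding ij(1,4) redb by blast
  next
    fix i j a b c d assume "i \<in> H \<times> set Ss" "j \<in> H \<times> set Ss"
      and ab: "(a, b) \<in> blue (\<beta> i)" "(c, d) \<in> blue (\<beta> j)" "a - b - (c - d) \<in> L"
    then obtain x S y T where ij: "i = (x, S)" "x \<in> H" "S \<in> set Ss" "j = (y, T)" "y \<in> H" "T \<in> set Ss" by auto
    show "i = j \<and> a = c"
      using once[OF blue ij(2,3,5,6) _ _ ab(3)] ab(1,2) unfolding ij(1,4) blueb[OF ij(2)] blueb[OF ij(5)] by blast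
  qed
  moreover have "{(p, q). p \<in> range \<rho> \<and> q \<in> range \<rho> \<and> p - q \<in> D} =
      {((a, i), (b, j)). a \<in> {0..<N} \<and> b \<in> {0..<N} \<and> i \<in> {0..<w} \<and> j \<in> {0..<w} \<and> a \<noteq> b}"
  proof -
    have "N dvd a - b \<longleftrightarrow> a = b" if "a \<in> {0..<N}" "b \<in> {0..<N}" for a b
      using that by (auto simp: mod_eq_dvd_iff[symmetric])
    then show ?thesis unfolding range D_def by auto
  qed
  ultimately show ?thesis by simp
qed

lemma decomposable_multipartite_scaled:
  fixes N w :: nat
  assumes cert: "scaled_certificate k (int w) Ss" and N: "coprime N 30" and w: "w > 0" and k: "k > 0"
  shows "decomposable k (multipartite {..<N} w)"
proof -
  let ?E = "{((a, i), (b, j)). a \<in> {0..<int N} \<and> b \<in> {0..<int N} \<and> i \<in> {0..<int w} \<and> j \<in> {0..<int w} \<and> a \<noteq> b}"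
  let ?f = "map_prod nat nat"
  have "N > 0" using N by (auto intro: Nat.gr0I)
  moreover have "coprime (int N) 30" using N by (metis coprime_int_iff of_nat_numeral)
  ultimately have dec: "decomposable k ?E" using w by (intro scaled_difference_family[OF cert]) simp_all
  have "map_prod ?f ?f ` ?E = multipartite {..<N} w"
  proof
    show "map_prod ?f ?f ` ?E \<subseteq> multipartite {..<N} w"
      unfolding multipartite_def by auto
    show "multipartite {..<N} w \<subseteq> map_prod ?f ?f ` ?E"
    proof
      fix e assume "e \<in> multipartite {..<N} w"
      then obtain a i b j where e: "e = ((a, i), (b, j))" "a < N" "b < N" "a \<noteq> b" "i < w" "j < w"
        unfolding multipartite_def by auto
      then show "e \<in> map_prod ?f ?f ` ?E"
        by (intro image_eqI[of _ _ "((int a, int i), (int b, int j))"]) auto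
    qed
  qed
  moreover have "decomposable k (map_prod ?f ?f ` ?E)"
  proof (rule decomposable_image[OF dec])
    show "?E \<subseteq> ({0..} \<times> {0..}) \<times> ({0..} \<times> {0..})" by auto
    show "inj_on ?f ({0..} \<times> {0..})" by (auto simp: inj_on_def)
  qed fact
  ultimately show ?thesis by simp
qed


section \<open>Truncated transversal designs\<close>

text \<open>Indices of groups \<open>0\<close> to \<open>7\<close> differ by at most
  \<open>7\<close>, and these differences have to be invertible modulo \<open>N\<close>. The square
  of \<open>210\<close> is used because \<open>4\<close> does not divide \<open>210\<close>.\<close>

lemma coprime_210_small:
  fixes N d :: int
  assumes "coprime N 210" "0 < d" "d < 8"
  shows "coprime N d"
proof -
  have "d = 1 \<or> d = 2 \<or> d = 3 \<or> d = 4 \<or> d = 5 \<or> d = 6 \<or> d = 7" using assms(2,3) by presburger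
  then have "d dvd 210 ^ 2" by (elim disjE) simp_all
  moreover have "coprime N (210 ^ 2)" using assms(1) unfolding coprime_power_right_iff by simp
  ultimately show ?thesis using coprime_divisors[of N N d "210 ^ 2"] by simp
qed

text \<open>The lines of a transversal design with nine groups; group \<open>8\<close> plays the role of the points
  at infinity, so \<open>line N l 8\<close> is the slope.\<close>

definition line :: "int \<Rightarrow> int \<times> int \<Rightarrow> nat \<Rightarrow> int" where
  "line N l j = (if j = 8 then snd l else (fst l + int j * snd l) mod N)"

text \<open>For \<open>j < 8\<close>, subtracting the two congruences leaves
  \<open>(j - i) * (b - b')\<close> divisible by \<open>N\<close> with \<open>j - i\<close>
  invertible; for \<open>j = 8\<close> the slopes agree outright. The intercepts then agree as
  well.\<close>

lemma line_unique:
  assumes N: "coprime N 210" and l: "l \<in> {0..<N} \<times> {0..<N}" "l' \<in> {0..<N} \<times> {0..<N}"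
    and j: "i < j" "j < 9" and eq: "line N l i = line N l' i" "line N l j = line N l' j"
  shows "l = l'"
proof -
  obtain a b a' b' where ab: "l = (a, b)" "l' = (a', b')" by (cases l; cases l')
  have i: "N dvd (a + int i * b) - (a' + int i * b')"
    using eq(1) j unfolding line_def ab by (simp add: mod_eq_dvd_iff)
  have "b = b'"
  proof (cases "j = 8")
    case True
    then show ?thesis using eq(2) unfolding line_def ab by simp
  next
    case False
    then have "N dvd (a + int j * b) - (a' + int j * b')"
      using eq(2) unfolding line_def ab by (simp add: mod_eq_dvd_iff)
    from dvd_diff[OF this i] have "N dvd (int j - int i) * (b - b')"
      by (simp add: algebra_simps)
    moreover have "coprime N (int j - int i)" using coprime_210_small[OF N] j False by simp
    ultimately have "N dvd b - b'" by (simp add: coprime_dvd_mult_right_iff)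
    then have "b mod N = b' mod N" by (simp add: mod_eq_dvd_iff)
    then show ?thesis using l unfolding ab by simp
  qed
  with i have "N dvd a - a'" by simp
  then have "a mod N = a' mod N" by (simp add: mod_eq_dvd_iff)
  then have "a = a'" using l unfolding ab by simp
  with \<open>b = b'\<close> show ?thesis unfolding ab by simp
qed

text \<open>The slope is \<open>y\<close> if \<open>j = 8\<close> and otherwise
  \<open>(y - x) / (j - i)\<close> modulo \<open>N\<close>; the intercept is then read off from
  group \<open>i\<close>.\<close>

lemma line_exists:
  assumes N: "coprime N 210" "N > 0" and j: "i < j" "j < 9" and x: "x \<in> {0..<N}" and y: "y \<in> {0..<N}"
  shows "\<exists>l\<in>{0..<N} \<times> {0..<N}. line N l i = x \<and> line N l j = y"
proof -
  have "\<exists>b\<in>{0..<N}. \<forall>a. (a + int i * b) mod N = x \<longrightarrow> line N (a, b) j = y"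
  proof (cases "j = 8")
    case True
    then show ?thesis using y unfolding line_def by auto
  next
    case False
    then have "coprime N (int j - int i)" using coprime_210_small[OF N(1)] j by simp
    then obtain t where "[(int j - int i) * t = 1] (mod N)"
      using cong_solve_coprime_int[of "int j - int i" N] by (auto simp: coprime_commute)
    then have "[(int j - int i) * t * (y - x) = 1 * (y - x)] (mod N)" by (rule cong_scalar_right)
    then have t: "[(int j - int i) * (t * (y - x)) = y - x] (mod N)" by (simp add: mult.assoc)
    define b where "b = t * (y - x) mod N"
    have "[(int j - int i) * b = y - x] (mod N)"
      using t unfolding b_def cong_def by (simp add: mod_mult_right_eq)
    then have b: "N dvd (int j - int i) * b - (y - x)" by (simp add: cong_iff_dvd_diff)
    have "line N (a, b) j = y" if "(a + int i * b) mod N = x" for a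
    proof -
      have "(a + int i * b) mod N = x mod N" using that x by simp
      then have "N dvd (a + int i * b) - x" by (simp add: mod_eq_dvd_iff)
      from dvd_add[OF this b] have "N dvd (a + int j * b) - y" by (simp add: algebra_simps)
      then have "(a + int j * b) mod N = y mod N" by (simp add: mod_eq_dvd_iff)
      then show ?thesis using y False unfolding line_def by simp
    qed
    moreover have "b \<in> {0..<N}" unfolding b_def using N(2) by simp
    ultimately show ?thesis by blast
  qed
  then obtain b where b: "b \<in> {0..<N}" "\<And>a. (a + int i * b) mod N = x \<Longrightarrow> line N (a, b) j = y" by blast
  define a where "a = (x - int i * b) mod N"
  have "(a + int i * b) mod N = (x - int i * b + int i * b) mod N"
    unfolding a_def by (rule mod_add_left_eq)
  then have a: "(a + int i * b) mod N = x" using x by simp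
  moreover have "a \<in> {0..<N}" unfolding a_def using N(2) by simp
  ultimately show ?thesis using b j unfolding line_def[of N "(a, b)" i] by (intro bexI[of _ "(a, b)"]) (auto simp: line_def)
qed

text \<open>Groups \<open>0\<close> to \<open>6\<close> stay full, while groups \<open>7\<close> and
  \<open>8\<close> are cut down to \<open>s\<close> and \<open>t\<close> points. Two surviving
  points lie in one group or on one line, so groups (\<open>Inl\<close>) and truncated lines
  (\<open>Inr\<close>) form a pairwise balanced design. Its groups have \<open>N\<close>,
  \<open>s\<close> or \<open>t\<close> points and its lines \<open>7\<close>, \<open>8\<close> or
  \<open>9\<close>.\<close>

lemma decomposable_truncated:
  fixes N s t :: nat
  assumes N: "coprime N 210" "N > 0" and st: "s \<le> N" "t \<le> N" and k: "k > 0"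
    and small: "\<And>c::nat. c \<in> {7, 8, 9, N, s, t} \<Longrightarrow> decomposable k (multipartite {..<c} w)"
  shows "decomposable k (multipartite {..<7 * N + s + t} w)"
proof -
  define lim where "lim j = (if j < 7 then N else if j = 7 then s else t)" for j :: nat
  define S where "S = (SIGMA j:{..<9::nat}. {0..<int (lim j)})"
  define pt where "pt l j = (j, line (int N) l j)" for l j
  define T where "T i = (case i of Inl j \<Rightarrow> {j} \<times> {0..<int (lim j)} | Inr l \<Rightarrow> range (pt l) \<inter> S)" for i :: "nat + int \<times> int"
  define I where "I = Inl ` {..<9::nat} \<union> Inr ` ({0..<int N} \<times> {0..<int N})"
  have N': "coprime (int N) 210" using N(1) by (metis coprime_int_iff of_nat_numeral)
  have small': "decomposable k (multipartite X w)" if "finite X" "card X \<in> {7, 8, 9, N, s, t}" for X :: "(nat \<times> int) set"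
    by (rule decomposable_multipartite_transfer[OF small[OF that(2)]]) (use that k in auto)
  have lim: "lim j \<in> {N, s, t}" "lim j \<le> N" for j using st unfolding lim_def by auto
  have finS: "finite S" unfolding S_def by auto
  have cardS: "card S = 7 * N + s + t"
  proof -
    have "card S = (\<Sum>j<9. lim j)" unfolding S_def by (subst card_SigmaI) auto
    also have "\<dots> = 7 * N + s + t" by (simp add: lim_def eval_nat_numeral)
    finally show ?thesis .
  qed
  have "decomposable k (multipartite S w)"
  proof (rule decomposable_pairwise_balanced[where I = I and T = T])
    fix i assume "i \<in> I"
    then consider j where "i = Inl j" | l where "i = Inr l" "l \<in> {0..<int N} \<times> {0..<int N}"
      unfolding I_def by blast
    then show "decomposable k (multipartite (T i) w)"
    proof cases
      case 1
      then show ?thesis using lim(1)[of j] unfolding T_def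
        by (intro small') (auto simp: card_cartesian_product_singleton)
    next
      case 2
      \<comment> \<open>\<open>J\<close> collects the groups in which the line survives: all seven
        full ones and possibly the truncated two.\<close>
      define J where "J = {j. pt l j \<in> S}"
      have T: "T i = pt l ` J" unfolding T_def J_def 2 by auto
      have "{..<7} \<subseteq> J"
        using 2(2) N(2) unfolding J_def S_def pt_def lim_def line_def by auto
      moreover have "J \<subseteq> {..<9}" unfolding J_def S_def pt_def by auto
      ultimately have "7 \<le> card J" "card J \<le> 9" "finite J"
        using card_mono[of J "{..<7}"] card_mono[of "{..<9}" J] finite_subset[of J "{..<9}"] by auto
      moreover have "card (T i) = card J" unfolding T by (rule card_image) (auto simp: inj_on_def pt_def)
      ultimately show ?thesis by (intro small') (auto simp: T)
    qed
  next
    fix p q assume p: "p \<in> S" and q: "q \<in> S" and ne: "p \<noteq> q"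
    obtain i x j y where pq: "p = (i, x)" "q = (j, y)" by (cases p; cases q)
    have ij: "i < 9" "j < 9" "x \<in> {0..<int N}" "y \<in> {0..<int N}"
      using p q lim(2)[of i] lim(2)[of j] unfolding pq S_def by auto
    have lines: "\<exists>l\<in>{0..<int N} \<times> {0..<int N}. pt l i = p \<and> pt l j = q" if "i \<noteq> j"
      using line_exists[OF N', of i j x y] line_exists[OF N', of j i y x] ij that N(2)
      unfolding pt_def pq by (cases "i < j") auto
    show "\<exists>i\<in>I. p \<in> T i \<and> q \<in> T i"
    proof (cases "i = j")
      case True
      then show ?thesis using p q ij unfolding pq S_def I_def T_def
        by (intro bexI[of _ "Inl i"]) auto
    next
      case False
      with lines obtain l where "l \<in> {0..<int N} \<times> {0..<int N}" "pt l i = p" "pt l j = q" by blast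
      then show ?thesis using p q unfolding I_def T_def
        by (intro bexI[of _ "Inr l"]) (auto intro: range_eqI[OF sym])
    qed
  next
    fix p q i j assume ij: "i \<in> I" "j \<in> I" and ne: "p \<noteq> q" and Ti: "{p, q} \<subseteq> T i" and Tj: "{p, q} \<subseteq> T j"
    have inr: "fst p \<noteq> fst q" if "{p, q} \<subseteq> T (Inr l)" for l
      using that ne unfolding T_def pt_def by auto
    have inl: "fst p = m \<and> fst q = m" if "{p, q} \<subseteq> T (Inl m)" for m
      using that unfolding T_def by auto
    have rr: "l = l'" if l: "i = Inr l" "j = Inr l'" for l l'
    proof -
      have "line (int N) l (fst p) = line (int N) l' (fst p)" "line (int N) l (fst q) = line (int N) l' (fst q)"
        using Ti Tj unfolding l T_def pt_def by auto
      moreover have "fst p < 9" "fst q < 9" using Ti unfolding l T_def S_def by auto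
      moreover have "fst p \<noteq> fst q" using inr Ti unfolding l .
      moreover have "l \<in> {0..<int N} \<times> {0..<int N}" "l' \<in> {0..<int N} \<times> {0..<int N}"
        using ij unfolding l I_def by auto
      ultimately show ?thesis
        using line_unique[OF N', of l l' "fst p" "fst q"] line_unique[OF N', of l l' "fst q" "fst p"]
        by (cases "fst p < fst q") auto
    qed
    show "i = j"
    proof (cases i)
      case (Inl a)
      note i = this
      show ?thesis
      proof (cases j)
        case (Inl b)
        then show ?thesis using inl[of a] inl[of b] Ti Tj i by simp
      next
        case (Inr l)
        then show ?thesis using inl[of a] inr[of l] Ti Tj i by simp
      qed
    next
      case (Inr l)
      note i = this
      show ?thesis
      proof (cases j)
        case (Inl a)
        then show ?thesis using inl[of a] inr[of l] Ti Tj i by simp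
      next
        case (Inr l')
        then show ?thesis using rr[OF i] i by simp
      qed
    qed
  next
    fix i assume "i \<in> I"
    then consider j where "i = Inl j" "j < 9" | l where "i = Inr l" unfolding I_def by blast
    then show "T i \<subseteq> S"
    proof cases
      case 1
      then show ?thesis unfolding T_def S_def by auto
    next
      case 2
      then show ?thesis unfolding T_def by simp
    qed
  qed
  then show ?thesis
    by (rule decomposable_multipartite_transfer[OF _ finS]) (simp_all add: cardS k)
qed

section \<open>Choosing the parameters of the truncation\<close>

lemma coprime_prime_iff: "prime p \<Longrightarrow> coprime x p \<longleftrightarrow> \<not> p dvd x" for p x :: nat
  by (metis coprime_commute prime_imp_coprime coprime_absorb_left not_prime_unit)

lemma coprime_30_iff: "coprime x 30 \<longleftrightarrow> \<not> 2 dvd x \<and> \<not> 3 dvd x \<and> \<not> 5 dvd x" for x :: nat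
  using coprime_mult_right_iff[of x "2 * 3" 5] coprime_mult_right_iff[of x 2 3]
    coprime_prime_iff[of 2 x] coprime_prime_iff[of 3 x] coprime_prime_iff[of 5 x] by simp

lemma coprime_210_iff: "coprime x 210 \<longleftrightarrow> coprime x 30 \<and> \<not> 7 dvd x" for x :: nat
  using coprime_mult_right_iff[of x 30 7] coprime_prime_iff[of 7 x] by simp

text \<open>Take \<open>t\<close> as the parity of \<open>m\<close>, so that
  \<open>n = m - t\<close> is even and an odd \<open>N\<close> makes \<open>s = n - 7 * N\<close>
  odd. If \<open>N\<close> is congruent to \<open>r\<close> modulo \<open>210\<close>, then
  \<open>s\<close> is congruent to \<open>n - r\<close> modulo \<open>3\<close> and to
  \<open>n - 2 * r\<close> modulo \<open>5\<close>, so a suitable residue \<open>r\<close> makes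
  \<open>s\<close> coprime to \<open>30\<close>.\<close>

lemma truncation_exists:
  fixes m :: nat
  assumes "m \<ge> 14000"
  shows "\<exists>N s t. m = 7 * N + s + t \<and> coprime N 210 \<and> coprime s 30 \<and> s \<le> N \<and> t \<le> 1"
proof -
  define t where "t = m mod 2"
  define n where "n = m - t"
  have t: "t \<le> 1" "m = n + t" "even n" unfolding t_def n_def by auto
  \<comment> \<open>All four candidates are coprime to \<open>210\<close>, and together they realise
    each combination of \<open>r mod 3\<close> in \<open>{1, 2}\<close> with
    \<open>2 * r mod 5\<close> equal or unequal to \<open>2\<close>.\<close>
  obtain r where r: "r \<in> {1, 11, 13, 17}" "r mod 3 \<noteq> n mod 3" "2 * r mod 5 \<noteq> n mod 5"
  proof
    let ?r = "if n mod 3 = 1 then if n mod 5 = 2 then 17 else 11 else if n mod 5 = 2 then 13 else 1 :: nat"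
    show "?r \<in> {1, 11, 13, 17}" "?r mod 3 \<noteq> n mod 3" "2 * ?r mod 5 \<noteq> n mod 5" by auto
  qed
  \<comment> \<open>\<open>N \<ge> q\<close> gives \<open>8 * N \<ge> n\<close>, that is
    \<open>s \<le> N\<close>. Rounding up costs less than \<open>240\<close>, so
    \<open>7 * N \<le> n\<close> holds once \<open>n\<close> is at least
    \<open>8 * 7 * 240 = 13440\<close>; this is why \<open>14000\<close> suffices.\<close>
  define q where "q = n div 8 + 1"
  define c where "c = (q + 209) div 210"
  define N where "N = 210 * c + r"
  have bounds: "q \<le> N" "N < q + 240" using r(1) unfolding N_def c_def by auto
  have "7 * N \<le> n" using bounds(2) t assms unfolding q_def by linarith
  then obtain s where s: "n = 7 * N + s" using le_Suc_ex by blast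
  have "s \<le> N" using bounds(1) s unfolding q_def by linarith
  moreover have "coprime N 210"
  proof -
    have "p dvd N \<longleftrightarrow> p dvd r" if "p dvd 210" for p
      unfolding N_def using that by (simp add: dvd_add_right_iff)
    then show ?thesis unfolding coprime_210_iff coprime_30_iff using r(1) by auto
  qed
  moreover have "coprime s 30"
    unfolding coprime_30_iff
  proof (intro conjI)
    have "odd N" using r(1) unfolding N_def by auto
    then show "\<not> 2 dvd s" using s t(3) by simp
    show "\<not> 3 dvd s"
    proof
      assume "3 dvd s"
      then obtain u where "s = 3 * u" ..
      then have "n = r + 3 * (490 * c + 2 * r + u)" using s unfolding N_def by simp
      then have "n mod 3 = r mod 3" by (simp only: mod_mult_self2)
      with r(2) show False by simp
    qed
    show "\<not> 5 dvd s"
    proof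
      assume "5 dvd s"
      then obtain u where "s = 5 * u" ..
      then have "n = 2 * r + 5 * (294 * c + r + u)" using s unfolding N_def by simp
      then have "n mod 5 = 2 * r mod 5" by (simp only: mod_mult_self2)
      with r(3) show False by simp
    qed
  qed
  moreover have "m = 7 * N + s + t" using s t(2) by simp
  ultimately show ?thesis using t(1) by blast
qed

section \<open>Decompositions of large complete graphs\<close>

text \<open>The sizes needed by the truncated design are supplied as follows: \<open>7\<close>,
  \<open>N\<close> and \<open>s\<close> are coprime to \<open>30\<close>, \<open>8\<close> and
  \<open>9\<close> are assumed separately, and \<open>t\<close> is at most \<open>1\<close>.\<close>

lemma decomposable_complete_large:
  fixes k w m :: nat
  assumes k: "k > 0" and base: "decomposable k (complete_graph {..<w + 1})"
    and cop: "\<And>N. coprime N 30 \<Longrightarrow> decomposable k (multipartite {..<N::nat} w)"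
    and "decomposable k (multipartite {..<8::nat} w)" "decomposable k (multipartite {..<9::nat} w)"
    and m: "m \<ge> 14000"
  shows "decomposable k (complete_graph {1..m * w + 1})"
proof -
  obtain N s t where N: "m = 7 * N + s + t" "coprime N 210" "coprime s 30" "s \<le> N" "t \<le> 1"
    using truncation_exists[OF m] by blast
  have "N > 0" using N m by (intro Nat.gr0I) simp
  have N30: "coprime N 30" using N(2) unfolding coprime_210_iff by simp
  \<comment> \<open>At most one part has no edges; size \<open>1\<close> is read off from the
    coprime case.\<close>
  have t: "decomposable k (multipartite {..<t} w)"
  proof (cases "t = 0")
    case True
    then have "multipartite {..<t} w = {}" by (auto simp: multipartite_def)
    then show ?thesis using decomposable_empty[of k] by simp
  next
    case False
    then have "t = 1" using N(5) by simp
    then show ?thesis using cop[of 1] by simp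
  qed
  have "decomposable k (multipartite {..<7::nat} w)" by (rule cop) (simp add: coprime_30_iff)
  then have "decomposable k (multipartite {..<m} w)"
    unfolding N(1) using assms(4,5) cop[OF N30] cop[OF N(3)] t N(4,5) \<open>N > 0\<close>
    by (intro decomposable_truncated[OF N(2)] k) auto
  moreover have "decomposable k (complete_graph {..w})"
    using base by (simp add: lessThan_Suc_atMost)
  ultimately show ?thesis using k by (rule decomposable_complete_of_multipartite)
qed

section \<open>Base blocks for \<open>k = 2\<close> and \<open>k = 3\<close>\<close>

lemma decomposable_complete_2:
  assumes "m \<ge> (14000::nat)"
  shows "decomposable 2 (complete_graph {1..m * 8 + 1})"
proof (rule decomposable_complete_large)
  \<comment> \<open>A single block suffices: its eight ordered red differences are the nonzero
    residues modulo \<open>9\<close>.\<close>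
  have "cyclic_certificate 2 9 9 [([4, 3], [0, 2])]" by code_simp
  then show "decomposable 2 (complete_graph {..<8 + 1 :: nat})"
    by (intro decomposable_complete_cyclic) simp_all
  have "scaled_certificate 2 8
      [([(1, 5), (0, 3)], [(3, 3), (2, 2)]),
       ([(1, 6), (2, 4)], [(3, 7), (0, 2)])]"
    by code_simp
  then show "decomposable 2 (multipartite {..<N} 8)" if "coprime N 30" for N :: nat
    using that by (intro decomposable_multipartite_scaled) simp_all
  \<comment> \<open>For \<open>h\<close> parts of size \<open>w = 2 * k ^ 2\<close> there are
    \<open>(h - 1) * w\<close> residues modulo \<open>h * w\<close> to cover and \<open>w\<close>
    red differences per block, hence \<open>h - 1\<close> blocks: seven here and eight for nine
    parts.\<close>
  have "cyclic_certificate 2 8 64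
      [([38, 18], [49, 31]), ([52, 19], [24, 34]), ([4, 15], [45, 42]), ([6, 41], [60, 58]),
       ([57, 0], [43, 58]), ([38, 15], [35, 40]), ([2, 53], [31, 57])]"
    by code_simp
  then show "decomposable 2 (multipartite {..<8::nat} 8)"
    by (intro decomposable_multipartite_cyclic) simp_all
  have "cyclic_certificate 2 9 72
      [([59, 10], [49, 36]), ([5, 46], [17, 60]), ([50, 35], [22, 46]), ([45, 10], [52, 66]),
       ([1, 68], [21, 20]), ([53, 20], [12, 19]), ([14, 11], [46, 8]), ([70, 18], [20, 3])]"
    by code_simp
  then show "decomposable 2 (multipartite {..<9::nat} 8)"
    by (intro decomposable_multipartite_cyclic) simp_all
qed (use assms in simp_all)

lemma decomposable_complete_3:
  assumes "m \<ge> (14000::nat)"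
  shows "decomposable 3 (complete_graph {1..m * 18 + 1})"
proof (rule decomposable_complete_large)
  \<comment> \<open>Again one block: its \<open>18\<close> ordered red differences are the nonzero
    residues modulo \<open>19\<close>.\<close>
  have "cyclic_certificate 3 19 19 [([17, 2, 18], [13, 1, 11])]" by code_simp
  then show "decomposable 3 (complete_graph {..<18 + 1 :: nat})"
    by (intro decomposable_complete_cyclic) simp_all
  have "scaled_certificate 3 18
      [([(1, 2), (5, 4), (3, 15)], [(6, 9), (4, 5), (0, 6)]),
       ([(3, 9), (1, 4), (5, 2)], [(4, 10), (0, 9), (6, 6)])]"
    by code_simp
  then show "decomposable 3 (multipartite {..<N} 18)" if "coprime N 30" for N :: nat
    using that by (intro decomposable_multipartite_scaled) simp_all
  have "cyclic_certificate 3 8 144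
      [([11, 133, 137], [142, 143, 60]), ([122, 64, 124], [121, 62, 91]),
       ([40, 23, 86], [58, 137, 125]), ([138, 135, 35], [101, 14, 121]),
       ([45, 100, 64], [71, 26, 1]), ([50, 7, 141], [105, 126, 72]), ([0, 94, 105], [4, 11, 53])]"
    by code_simp
  then show "decomposable 3 (multipartite {..<8::nat} 18)"
    by (intro decomposable_multipartite_cyclic) simp_all
  have "cyclic_certificate 3 9 162
      [([59, 63, 51], [143, 20, 120]), ([13, 93, 140], [161, 28, 69]),
       ([50, 49, 65], [152, 3, 91]), ([140, 11, 130], [66, 133, 153]),
       ([27, 103, 84], [161, 136, 52]), ([55, 111, 69], [77, 25, 74]),
       ([78, 40, 109], [30, 113, 107]), ([156, 151, 101], [5, 150, 139])]"
    by code_simp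
  then show "decomposable 3 (multipartite {..<9::nat} 18)"
    by (intro decomposable_multipartite_cyclic) simp_all
qed (use assms in simp_all)

section \<open>The exact values of the maximum code size\<close>

lemma real_max_code:
  assumes "decomposable k (complete_graph {1..n})" and "k > 0"
  shows "real (max_code n k (2 * k - 1)) = real n * (real n - 1) / real (2 * k ^ 2)"
proof -
  have "real (max_code n k (2 * k - 1)) * real (2 * k ^ 2) = real (n * (n - 1))"
    unfolding max_code_of_decomposable[OF assms, symmetric] by (rule of_nat_mult[symmetric])
  \<comment> \<open>For \<open>n = 0\<close> the truncated subtraction is harmless, because the
    factor \<open>n\<close> vanishes.\<close>
  also have "\<dots> = real n * (real n - 1)" by (cases n) (simp_all add: algebra_simps)
  finally show ?thesis using assms(2) by (simp add: field_simps)
qed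

theorem theorem1:
  shows "\<exists>n0::nat.
    (\<forall>n::nat. [n = 1] (mod 8) \<and> n > n0 \<longrightarrow>
       real (max_code n 2 3) = real n * (real n - 1) / 8) \<and>
    (\<forall>n::nat. ([n = 1] (mod 342) \<or> [n = 19] (mod 342)) \<and> n > n0 \<longrightarrow>
       real (max_code n 3 5) = real n * (real n - 1) / 18)"
proof (intro exI conjI allI impI)
  \<comment> \<open>The bound \<open>18 * 14000\<close> serves both claims, making
    \<open>n div 8\<close> and \<open>n div 18\<close> at least \<open>14000\<close>.\<close>
  fix n :: nat
  assume n: "[n = 1] (mod 8) \<and> n > 18 * 14000"
  then have "n = (n div 8) * 8 + 1" "n div 8 \<ge> 14000"
    using div_mult_mod_eq[of n 8] by (auto simp: cong_def)
  with decomposable_complete_2[of "n div 8"] have "decomposable 2 (complete_graph {1..n})" by metis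
  from real_max_code[OF this] show "real (max_code n 2 3) = real n * (real n - 1) / 8" by simp
next
  fix n :: nat
  assume n: "([n = 1] (mod 342) \<or> [n = 19] (mod 342)) \<and> n > 18 * 14000"
  \<comment> \<open>\<open>342 = 18 * 19\<close>, and \<open>1\<close> and \<open>19\<close> are
    both \<open>1\<close> modulo \<open>18\<close>.\<close>
  have "n mod 18 = n mod 342 mod 18" by (rule mod_mod_cancel[symmetric]) simp
  also have "\<dots> = 1" using n by (auto simp: cong_def)
  finally have "n = (n div 18) * 18 + 1" "n div 18 \<ge> 14000"
    using n div_mult_mod_eq[of n 18] by auto
  with decomposable_complete_3[of "n div 18"] have "decomposable 3 (complete_graph {1..n})" by metis
  from real_max_code[OF this] show "real (max_code n 3 5) = real n * (real n - 1) / 18" by simp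
qed

end
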